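(* Let $\boldsymbol{A}$ be a pseudocomplemented distributive lattice and let $\Sigma$ be the set of universal sentences defined in the context. Then $\boldsymbol{A}\vDash\Sigma$ if and only if $\boldsymbol{B}_*$ has a free skeleton for every finite subalgebra $\boldsymbol{B}$ of $\boldsymbol{A}$.
   Context: A pseudocomplemented distributive lattice is an algebra $\langle A;\wedge,\vee,\neg,0,1\rangle$ with $\langle A;\wedge,\vee,0,1\rangle$ a bounded distributive lattice and $a\leq\neg b\iff a\wedge b=0$ for all $a,b$. For a finite such $\boldsymbol{B}$, $\boldsymbol{B}_*$ is the poset of prime filters of its bounded lattice reduct ordered by inclusion (prime filters are proper and nonempty). Free skeleton: for a poset $X$ and $x\in X$, ${\uparrow}x=\{y\in X:x\leq y\}$, and for $Y\subseteq X$, $\max Y$ is the set of maximal elements of the subposet $Y$. A poset $X$ with minimum $\bot$ has a free skeleton when there are elements $s_{x,Y}\in X$, for $x\in X$ and nonempty $Y\subseteq\max{\uparrow}x$, such that: (i) for all $x\in X$ and nonempty $Y\subseteq\max{\uparrow}x$, $s_{x,Y}\in{\uparrow}x$ and $Y=\max{\uparrow}s_{x,Y}$; (ii) for all $x\in X$ and nonempty $Y,Z\subseteq\max{\uparrow}x$, $Y\subseteq Z$ implies $s_{x,Z}\leq s_{x,Y}$; (iii) for all $x\in X$ and nonempty $Y\subseteq\max X$, $\max{\uparrow}x\subseteq Y$ implies $s_{\bot,Y}\leq x$. (Having a free skeleton includes having a minimum.) Formulas: first-order implication, conjunction and disjunction are written $\Rightarrow,\sqcap,\sqcup$ (indexed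 versions $\mathop{\sqcap}_{i},\bigsqcup_{i}$); for terms, $s\leq t$ abbreviates $s\wedge t\approx s$. Empty meets and joins of terms are $1$ and $0$. $\wp(n)$ is the powerset of $\{1,\dots,n\}$. For $\vec{x}=\langle x_1,\dots,x_n\rangle$ and $T\in\wp(n)$ let $a_T(\vec{x})=\bigwedge_{i\in T}x_i\wedge\bigwedge_{i\notin T}\neg x_i$, with $i$ ranging over $\{1,\dots,n\}$. Let $$\mathcal{S}(n)=\{\langle L,\mathcal{T}\rangle: L\in\wp(n),\ \mathcal{T}\subseteq\wp(n),\text{ and }\varnothing\neq L\subseteq\bigcap\mathcal{T}\},$$ partially ordered by $\langle L,\mathcal{T}\rangle\leq\langle L',\mathcal{T}'\rangle\iff L\supseteq L'$ and $\mathcal{T}\subseteq\mathcal{T}'$. For $\langle L,\mathcal{T}\rangle\in\mathcal{S}(n)$ let $p_L^{\mathcal{T}}(\vec{x})=\bigwedge_{i\in L}x_i\wedge\neg\neg\bigl(\bigvee_{T\in\mathcal{T}}a_T(\vec{x})\bigr)$. For $n\in\mathbb{Z}^+$ and a term $t=t(x_1,\dots,x_n)$ let $$\mathsf{At}_{t,n}(\vec{x})= t\not\approx 0\ \sqcap\bigsqcup_{T\in\wp(n)}t\approx a_T(\vec{x}),$$ $$\mathsf{Jirr}_{t,n}(\vec{x})=\bigsqcup_{\langle L,\mathcal{T}\rangle\in\mathcal{S}(n)}\Bigl(t\approx p_L^{\mathcal{T}}(\vec{x})\ \sqcap\ t\not\approx\bigvee\{p_{L'}^{\mathcal{T}'}(\vec{x}):\langle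 L',\mathcal{T}'\rangle\in\mathcal{S}(n)\text{ and }\langle L',\mathcal{T}'\rangle<\langle L,\mathcal{T}\rangle\}\Bigr).$$ For disjoint tuples of variables $\vec{x}=\langle x_1,\dots,x_n\rangle$, $\vec{y}=\langle y_1,\dots,y_m\rangle$, $\vec{z}=\langle z_1,\dots,z_k\rangle$ (a term or formula applied to $\vec{x},\vec{y}$ is applied to the concatenated tuple), and quantifier-free formulas $P(\vec{x},\vec{y})$, $Q(\vec{x},\vec{y},\vec{z})$, let $F_{n,m,k}(\vec{x},\vec{y})$ be the formula $A\Rightarrow B$ with $$A=\mathsf{Jirr}_{x_1,n+m}(\vec{x},\vec{y})\sqcap\mathop{\sqcap}_{i=1}^m\mathsf{At}_{y_i,n+m}(\vec{x},\vec{y})\sqcap P(\vec{x},\vec{y}),$$ $$B=\bigsqcup_{\langle\langle L_1,\mathcal{T}_1\rangle,\dots,\langle L_k,\mathcal{T}_k\rangle\rangle\in\mathcal{S}(n+m)^k}\Bigl(Q(\vec{x},\vec{y},p_1,\dots,p_k)\sqcap\mathop{\sqcap}_{j=1}^k\mathsf{Jirr}_{p_j,n+m}(\vec{x},\vec{y})\Bigr),\qquad p_j=p_{L_j}^{\mathcal{T}_j}(\vec{x},\vec{y}).$$ For $1\leq h\leq m$ let $$P_{n,m,h}(\vec{x},\vec{y})=\mathop{\sqcap}_{i=1}^h y_i\leq x_1\ \sqcap\mathop{\sqcap}_{j=h+1}^m y_j\nleq x_1 .$$ For each $h\geq1$ fix a bijection $f:\{1,\dots,2^h-1\}\to\wp(h)\setminus\{\varnothing\}$,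 and for $\vec{z}=\langle z_1,\dots,z_{2^h-1}\rangle$ disjoint from $\vec{x}$ and $\vec{y}$ let $Q_{n,m,h}(\vec{x},\vec{y},\vec{z})$ be the conjunction of: $z_i\leq x_1$ for all $i\leq 2^h-1$; $z_i\leq z_j$ for all $i,j\leq 2^h-1$ with $f(i)\subseteq f(j)$; $y_j\leq z_i$ for all $i\leq 2^h-1$, $j\leq m$ with $j\in f(i)$; $y_j\nleq z_i$ for all $i\leq 2^h-1$, $j\leq m$ with $j\notin f(i)$. Let $\mathrm{FS}_{n,m,2^h-1}(\vec{x},\vec{y})$ be the formula $F_{n,m,2^h-1}(\vec{x},\vec{y})$ obtained from $P=P_{n,m,h}$ and $Q=Q_{n,m,h}$ (with $k=2^h-1$). Let $\mathrm{DN}(x,y,z)$ be $\neg\neg x= y\vee z\Rightarrow(y=\neg\neg x\sqcup z=\neg\neg x)$. Then $\Sigma$ is the set of universal closures of the formulas $0\not\approx1$, $\mathrm{DN}(x,y,z)$, and $\mathrm{FS}_{n,m,2^h-1}(\vec{x},\vec{y})$ for all $n,m,h\in\mathbb{Z}^+$ with $h\leq m$.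
   Formalization: In FS the premise P additionally requires y_1,…,y_h to be pairwise distinct; without this, x_1=y_1=y_2=1 (n=1, m=h=2) violates FS in every algebra with 0≠1, so Σ would have no model, although the two-element algebra satisfies the free skeleton condition. *)

theory Defs
  imports Main "HOL-Library.FuncSet"
begin

section \<open>Pseudocomplemented distributive lattices\<close>

class pseudocomp_distrib_lattice = distrib_lattice + bounded_lattice +
  fixes pcomp :: "'a \<Rightarrow> 'a"
  assumes le_pcomp_iff: "a \<le> pcomp b \<longleftrightarrow> inf a b = bot"

definition subalgebra :: "'a::pseudocomp_distrib_lattice set \<Rightarrow> bool" where
  "subalgebra B \<longleftrightarrow> bot \<in> B \<and> top \<in> B \<and>
     (\<forall>a\<in>B. \<forall>b\<in>B. inf a b \<in> B) \<and> (\<forall>a\<in>B. \<forall>b\<in>B. sup a b \<in> B) \<and> (\<forall>a\<in>B. pcomp a \<in> B)"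

definition prime_filter :: "'a::pseudocomp_distrib_lattice set \<Rightarrow> 'a set \<Rightarrow> bool" where
  "prime_filter B F \<longleftrightarrow> F \<subseteq> B \<and> F \<noteq> {} \<and> F \<noteq> B \<and>
     (\<forall>a\<in>F. \<forall>b\<in>B. a \<le> b \<longrightarrow> b \<in> F) \<and>
     (\<forall>a\<in>F. \<forall>b\<in>F. inf a b \<in> F) \<and>
     (\<forall>a\<in>B. \<forall>b\<in>B. sup a b \<in> F \<longrightarrow> a \<in> F \<or> b \<in> F)"

definition dual_poset :: "'a::pseudocomp_distrib_lattice set \<Rightarrow> 'a set set" where
  "dual_poset B = {F. prime_filter B F}"


section \<open>Free skeletons\<close>

text \<open>A poset is a set \<open>X\<close> of elements of an ordered type, with the induced order; for
  \<^term>\<open>dual_poset B\<close> this is inclusion.\<close>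

definition up :: "'b::order set \<Rightarrow> 'b \<Rightarrow> 'b set" where
  "up X x = {y \<in> X. x \<le> y}"

definition max_elems :: "'b::order set \<Rightarrow> 'b set" where
  "max_elems Y = {m \<in> Y. \<forall>y\<in>Y. m \<le> y \<longrightarrow> y = m}"

definition has_free_skeleton :: "'b::order set \<Rightarrow> bool" where
  "has_free_skeleton X \<longleftrightarrow>
     (\<exists>b\<in>X. (\<forall>x\<in>X. b \<le> x) \<and>
       (\<exists>s :: 'b \<Rightarrow> 'b set \<Rightarrow> 'b.
          (\<forall>x\<in>X. \<forall>Y. Y \<noteq> {} \<and> Y \<subseteq> max_elems (up X x) \<longrightarrow>
             s x Y \<in> up X x \<and> Y = max_elems (up X (s x Y))) \<and>
          (\<forall>x\<in>X. \<forall>Y Z. Y \<noteq> {} \<and> Z \<noteq> {} \<and>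
             Y \<subseteq> max_elems (up X x) \<and> Z \<subseteq> max_elems (up X x) \<and> Y \<subseteq> Z \<longrightarrow> s x Z \<le> s x Y) \<and>
          (\<forall>x\<in>X. \<forall>Y. Y \<noteq> {} \<and> Y \<subseteq> max_elems X \<and> max_elems (up X x) \<subseteq> Y \<longrightarrow> s b Y \<le> x)))"


section \<open>Terms, quantifier-free formulas, universal sentences\<close>

datatype trm = Var nat | ZeroT | OneT | Meet trm trm | Join trm trm | Neg trm

datatype fm = FTrue | FFalse | Eq trm trm | FNot fm | FAnd fm fm | FOr fm fm | FImp fm fm

datatype ufm = QF fm | All nat ufm

primrec vars_trm :: "trm \<Rightarrow> nat set" where
  "vars_trm (Var i) = {i}"
| "vars_trm ZeroT = {}"
| "vars_trm OneT = {}"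
| "vars_trm (Meet s t) = vars_trm s \<union> vars_trm t"
| "vars_trm (Join s t) = vars_trm s \<union> vars_trm t"
| "vars_trm (Neg s) = vars_trm s"

primrec vars_fm :: "fm \<Rightarrow> nat set" where
  "vars_fm FTrue = {}"
| "vars_fm FFalse = {}"
| "vars_fm (Eq s t) = vars_trm s \<union> vars_trm t"
| "vars_fm (FNot \<phi>) = vars_fm \<phi>"
| "vars_fm (FAnd \<phi> \<psi>) = vars_fm \<phi> \<union> vars_fm \<psi>"
| "vars_fm (FOr \<phi> \<psi>) = vars_fm \<phi> \<union> vars_fm \<psi>"
| "vars_fm (FImp \<phi> \<psi>) = vars_fm \<phi> \<union> vars_fm \<psi>"

primrec subst_trm :: "(nat \<Rightarrow> trm) \<Rightarrow> trm \<Rightarrow> trm" where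
  "subst_trm \<sigma> (Var i) = \<sigma> i"
| "subst_trm \<sigma> ZeroT = ZeroT"
| "subst_trm \<sigma> OneT = OneT"
| "subst_trm \<sigma> (Meet s t) = Meet (subst_trm \<sigma> s) (subst_trm \<sigma> t)"
| "subst_trm \<sigma> (Join s t) = Join (subst_trm \<sigma> s) (subst_trm \<sigma> t)"
| "subst_trm \<sigma> (Neg s) = Neg (subst_trm \<sigma> s)"

primrec subst_fm :: "(nat \<Rightarrow> trm) \<Rightarrow> fm \<Rightarrow> fm" where
  "subst_fm \<sigma> FTrue = FTrue"
| "subst_fm \<sigma> FFalse = FFalse"
| "subst_fm \<sigma> (Eq s t) = Eq (subst_trm \<sigma> s) (subst_trm \<sigma> t)"
| "subst_fm \<sigma> (FNot \<phi>) = FNot (subst_fm \<sigma> \<phi>)"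
| "subst_fm \<sigma> (FAnd \<phi> \<psi>) = FAnd (subst_fm \<sigma> \<phi>) (subst_fm \<sigma> \<psi>)"
| "subst_fm \<sigma> (FOr \<phi> \<psi>) = FOr (subst_fm \<sigma> \<phi>) (subst_fm \<sigma> \<psi>)"
| "subst_fm \<sigma> (FImp \<phi> \<psi>) = FImp (subst_fm \<sigma> \<phi>) (subst_fm \<sigma> \<psi>)"

definition univ_closure :: "fm \<Rightarrow> ufm" where
  "univ_closure \<phi> = foldr All (sorted_list_of_set (vars_fm \<phi>)) (QF \<phi>)"

primrec eval :: "(nat \<Rightarrow> 'a::pseudocomp_distrib_lattice) \<Rightarrow> trm \<Rightarrow> 'a" where
  "eval v (Var i) = v i"
| "eval v ZeroT = bot"
| "eval v OneT = top"
| "eval v (Meet s t) = inf (eval v s) (eval v t)"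
| "eval v (Join s t) = sup (eval v s) (eval v t)"
| "eval v (Neg s) = pcomp (eval v s)"

primrec sat_fm :: "(nat \<Rightarrow> 'a::pseudocomp_distrib_lattice) \<Rightarrow> fm \<Rightarrow> bool" where
  "sat_fm v FTrue \<longleftrightarrow> True"
| "sat_fm v FFalse \<longleftrightarrow> False"
| "sat_fm v (Eq s t) \<longleftrightarrow> eval v s = eval v t"
| "sat_fm v (FNot \<phi>) \<longleftrightarrow> \<not> sat_fm v \<phi>"
| "sat_fm v (FAnd \<phi> \<psi>) \<longleftrightarrow> sat_fm v \<phi> \<and> sat_fm v \<psi>"
| "sat_fm v (FOr \<phi> \<psi>) \<longleftrightarrow> sat_fm v \<phi> \<or> sat_fm v \<psi>"
| "sat_fm v (FImp \<phi> \<psi>) \<longleftrightarrow> (sat_fm v \<phi> \<longrightarrow> sat_fm v \<psi>)"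

primrec sat_ufm :: "(nat \<Rightarrow> 'a::pseudocomp_distrib_lattice) \<Rightarrow> ufm \<Rightarrow> bool" where
  "sat_ufm v (QF \<phi>) \<longleftrightarrow> sat_fm v \<phi>"
| "sat_ufm v (All i \<Phi>) \<longleftrightarrow> (\<forall>a. sat_ufm (v(i := a)) \<Phi>)"

definition models :: "'a::pseudocomp_distrib_lattice itself \<Rightarrow> ufm set \<Rightarrow> bool" where
  "models A \<Gamma> \<longleftrightarrow> (\<forall>\<Phi>\<in>\<Gamma>. \<forall>v :: nat \<Rightarrow> 'a. sat_ufm v \<Phi>)"

text \<open>Connectives indexed by a finite set are built along an arbitrary enumeration of it;
  up to equivalence the result does not depend on the enumeration.\<close>

definition list_of :: "'i set \<Rightarrow> 'i list" where
  "list_of I = (SOME xs. distinct xs \<and> set xs = I)"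

definition BigMeet :: "'i set \<Rightarrow> ('i \<Rightarrow> trm) \<Rightarrow> trm" where
  "BigMeet I t = foldr (\<lambda>i. Meet (t i)) (list_of I) OneT"

definition BigJoin :: "'i set \<Rightarrow> ('i \<Rightarrow> trm) \<Rightarrow> trm" where
  "BigJoin I t = foldr (\<lambda>i. Join (t i)) (list_of I) ZeroT"

definition BigAnd :: "'i set \<Rightarrow> ('i \<Rightarrow> fm) \<Rightarrow> fm" where
  "BigAnd I \<phi> = foldr (\<lambda>i. FAnd (\<phi> i)) (list_of I) FTrue"

definition BigOr :: "'i set \<Rightarrow> ('i \<Rightarrow> fm) \<Rightarrow> fm" where
  "BigOr I \<phi> = foldr (\<lambda>i. FOr (\<phi> i)) (list_of I) FFalse"

abbreviation Neq :: "trm \<Rightarrow> trm \<Rightarrow> fm" where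
  "Neq s t \<equiv> FNot (Eq s t)"

abbreviation Le :: "trm \<Rightarrow> trm \<Rightarrow> fm" where
  "Le s t \<equiv> Eq (Meet s t) s"

abbreviation NLe :: "trm \<Rightarrow> trm \<Rightarrow> fm" where
  "NLe s t \<equiv> FNot (Le s t)"


section \<open>The sentences\<close>

text \<open>The terms and formulas \<open>a\<close>, \<open>p\<close>, \<open>At\<close>, \<open>Jirr\<close> below are in the variables
  \<^term>\<open>Var 1\<close>, \dots, \<^term>\<open>Var n\<close>. In formulas over three tuples of lengths \<open>n\<close>, \<open>m\<close>, \<open>k\<close>,
  \<open>x\<^sub>i\<close> is \<^term>\<open>Var i\<close>, \<open>y\<^sub>j\<close> is \<^term>\<open>Var (n + j)\<close> and \<open>z\<^sub>l\<close> is \<^term>\<open>Var (n + m + l)\<close>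
  (indices starting at 1), so concatenating the first two tuples just replaces \<open>n\<close> by
  \<^term>\<open>n + m\<close>.\<close>

definition a_trm :: "nat \<Rightarrow> nat set \<Rightarrow> trm" where
  "a_trm n T = Meet (BigMeet T Var) (BigMeet ({1..n} - T) (\<lambda>i. Neg (Var i)))"

text \<open>\<^term>\<open>\<Inter>{}\<close> is \<^term>\<open>UNIV\<close>, so the family may be empty, for every nonempty \<open>L\<close>.\<close>

definition S_set :: "nat \<Rightarrow> (nat set \<times> nat set set) set" where
  "S_set n = {(L, \<T>). L \<in> Pow {1..n} \<and> \<T> \<subseteq> Pow {1..n} \<and> L \<noteq> {} \<and> L \<subseteq> \<Inter>\<T>}"

definition S_le :: "nat set \<times> nat set set \<Rightarrow> nat set \<times> nat set set \<Rightarrow> bool" where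
  "S_le c d \<longleftrightarrow> fst d \<subseteq> fst c \<and> snd c \<subseteq> snd d"

definition S_less :: "nat set \<times> nat set set \<Rightarrow> nat set \<times> nat set set \<Rightarrow> bool" where
  "S_less c d \<longleftrightarrow> S_le c d \<and> c \<noteq> d"

definition p_trm :: "nat \<Rightarrow> nat set \<times> nat set set \<Rightarrow> trm" where
  "p_trm n c = Meet (BigMeet (fst c) Var) (Neg (Neg (BigJoin (snd c) (a_trm n))))"

definition At_fm :: "trm \<Rightarrow> nat \<Rightarrow> fm" where
  "At_fm t n = FAnd (Neq t ZeroT) (BigOr (Pow {1..n}) (\<lambda>T. Eq t (a_trm n T)))"

definition Jirr_fm :: "trm \<Rightarrow> nat \<Rightarrow> fm" where
  "Jirr_fm t n = BigOr (S_set n) (\<lambda>c.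
     FAnd (Eq t (p_trm n c)) (Neq t (BigJoin {d \<in> S_set n. S_less d c} (p_trm n))))"

definition F_fm :: "nat \<Rightarrow> nat \<Rightarrow> nat \<Rightarrow> fm \<Rightarrow> fm \<Rightarrow> fm" where
  "F_fm n m k P Q =
     FImp
       (FAnd (Jirr_fm (Var 1) (n + m))
         (FAnd (BigAnd {1..m} (\<lambda>i. At_fm (Var (n + i)) (n + m))) P))
       (BigOr ({1..k} \<rightarrow>\<^sub>E S_set (n + m)) (\<lambda>w.
         FAnd
           (subst_fm (\<lambda>v. if v \<le> n + m then Var v else p_trm (n + m) (w (v - (n + m)))) Q)
           (BigAnd {1..k} (\<lambda>j. Jirr_fm (p_trm (n + m) (w j)) (n + m)))))"

definition P_fm :: "nat \<Rightarrow> nat \<Rightarrow> nat \<Rightarrow> fm" where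
  "P_fm n m h =
     FAnd (BigAnd {1..h} (\<lambda>i. Le (Var (n + i)) (Var 1)))
          (BigAnd {h+1..m} (\<lambda>j. NLe (Var (n + j)) (Var 1)))"

definition distinct_fm :: "nat \<Rightarrow> nat \<Rightarrow> fm" where
  "distinct_fm n h = BigAnd {(i, j). 1 \<le> i \<and> i < j \<and> j \<le> h} (\<lambda>(i, j). Neq (Var (n + i)) (Var (n + j)))"

definition Q_fm :: "nat \<Rightarrow> nat \<Rightarrow> nat \<Rightarrow> (nat \<Rightarrow> nat set) \<Rightarrow> fm" where
  "Q_fm n m h f =
     (let k = 2 ^ h - 1; y = (\<lambda>j. Var (n + j)); z = (\<lambda>i. Var (n + m + i)) in
      FAnd (BigAnd {1..k} (\<lambda>i. Le (z i) (Var 1)))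
     (FAnd (BigAnd {(i, j). i \<in> {1..k} \<and> j \<in> {1..k} \<and> f i \<subseteq> f j} (\<lambda>(i, j). Le (z i) (z j)))
     (FAnd (BigAnd {(i, j). i \<in> {1..k} \<and> j \<in> {1..m} \<and> j \<in> f i} (\<lambda>(i, j). Le (y j) (z i)))
           (BigAnd {(i, j). i \<in> {1..k} \<and> j \<in> {1..m} \<and> j \<notin> f i} (\<lambda>(i, j). NLe (y j) (z i))))))"

text \<open>The conjunct \<^term>\<open>distinct_fm n h\<close> (the atoms \<open>y\<^sub>1, \<dots>, y\<^sub>h\<close> below \<open>x\<^sub>1\<close> are pairwise
  distinct) is a correction: the source has \<open>P = P_fm n m h\<close> alone. Without it no algebra is a
  model of the sentences: if
  \<open>y\<^sub>1\<close> and \<open>y\<^sub>2\<close> take the same value and \<open>f i = {1}\<close>, then \<^term>\<open>Q_fm n m 2 f\<close> requires both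
  \<open>y\<^sub>1 \<le> z\<^sub>i\<close> and \<open>y\<^sub>2 \<nleq> z\<^sub>i\<close>, whereas the premise holds for \<open>x\<^sub>1 = y\<^sub>1 = y\<^sub>2 = 1\<close> already in
  the two-element algebra.\<close>

definition FS_fm :: "nat \<Rightarrow> nat \<Rightarrow> nat \<Rightarrow> (nat \<Rightarrow> nat set) \<Rightarrow> fm" where
  "FS_fm n m h f =
     F_fm n m (2 ^ h - 1) (FAnd (P_fm n m h) (distinct_fm n h)) (Q_fm n m h f)"

definition DN_fm :: fm where
  "DN_fm =
     (let x = Var 1; y = Var 2; z = Var 3 in
      FImp (Eq (Neg (Neg x)) (Join y z)) (FOr (Eq y (Neg (Neg x))) (Eq z (Neg (Neg x)))))"

text \<open>The argument \<open>f\<close> is the choice, for each \<open>h \<ge> 1\<close>, of an enumeration of the nonempty subsets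
  of \<open>{1, \<dots>, h}\<close>.\<close>

definition Sigma_ax :: "(nat \<Rightarrow> nat \<Rightarrow> nat set) \<Rightarrow> ufm set" where
  "Sigma_ax f =
     {univ_closure (Neq ZeroT OneT), univ_closure DN_fm} \<union>
     {univ_closure (FS_fm n m h (f h)) | n m h. 1 \<le> n \<and> 1 \<le> m \<and> 1 \<le> h \<and> h \<le> m}"

end

theory Submission
  imports Defs
begin

text \<open>The dual poset of a finite algebra \<open>B\<close> is anti-isomorphic to the set of join-irreducible
  elements of \<open>B\<close>: maximal prime filters correspond to atoms, and a least prime filter exists iff
  the top element is join-irreducible. A free skeleton therefore amounts to a choice, for every
  join-irreducible \<open>x\<close> and every nonempty set \<open>Y\<close> of atoms below \<open>x\<close>, of a join-irreducible
  \<open>s\<^sub>x\<^sub>,\<^sub>Y \<le> x\<close> that has exactly the atoms in \<open>Y\<close> below it, monotonically in \<open>Y\<close>, and such that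
  \<open>s\<^sub>1\<^sub>,\<^sub>Y\<close> is the largest join-irreducible element with atoms in \<open>Y\<close> (\<open>has_free_skeleton_iff\<close>).

  The sentences speak about just these data. Finitely many elements \<open>x\<^sub>1, \<dots>, x\<^sub>n\<close> generate a finite
  algebra, which consists of the joins of values of the terms \<open>p\<close>, with \<open>L = {}\<close> admitted
  (\<open>subalgebra_gen_alg\<close>). The reason is that the \<open>a\<^sub>T\<close> are pairwise disjoint, have a dense join, and
  are each zero or an atom of the generated algebra; so pseudocomplements are regular elements
  spanned by some of the \<open>a\<^sub>T\<close>. It follows that the formula \<open>At\<close> says that a term denotes an atom of
  the generated algebra (\<open>sat_At_fm\<close>), that \<open>Jirr\<close> says that it denotes a join-irreducible element
  of the form \<open>p\<close> (\<open>sat_Jirr_fm\<close>), and that below a generator every join-irreducible element has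
  this form. Hence \<open>FS\<close> states the existence of the skeleton elements \<open>s\<^sub>x\<^sub>,\<^sub>Y\<close> for \<open>x = x\<^sub>1\<close>
  (\<open>sat_FS_fm\<close>).

  If all finite subalgebras have free skeletons, then the one generated by the values of the
  variables supplies the witnesses for \<open>FS\<close>. Its element \<open>s\<^sub>1\<^sub>,\<^sub>Y\<close>, for \<open>Y\<close> the set of atoms
  below a nonzero \<open>\<not>\<not>x\<close>, is equal to \<open>\<not>\<not>x\<close>, which is therefore join-irreducible; this is \<open>DN\<close>.
  Conversely, let \<open>B\<close> be a finite subalgebra of a model. For \<open>x \<noteq> 1\<close> the elements \<open>s\<^sub>x\<^sub>,\<^sub>Y\<close> come from
  an instance of \<open>FS\<close> whose variables enumerate \<open>B\<close> and the atoms below \<open>x\<close>. For \<open>x = 1\<close> they are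
  \<open>\<not>\<not>\<Squnion>Y\<close>, which is join-irreducible by \<open>DN\<close> and is the largest element with atoms in \<open>Y\<close>.\<close>

section \<open>Pseudocomplements\<close>

lemma inf_pcomp: "inf b (pcomp b) = (bot :: 'a::pseudocomp_distrib_lattice)"
  using le_pcomp_iff[of "pcomp b" b] by (simp add: inf_commute)

lemma inf_eq_bot_mono:
  fixes a :: "'a::pseudocomp_distrib_lattice"
  assumes "inf c d = bot" "a \<le> c" "b \<le> d"
  shows "inf a b = bot"
  using assms by (metis bot.extremum_uniqueI inf_mono)

lemma le_pcomp_pcomp: "a \<le> pcomp (pcomp (a :: 'a::pseudocomp_distrib_lattice))"
  by (simp add: le_pcomp_iff inf_pcomp)

lemma pcomp_pcomp_top: "pcomp (pcomp top) = (top :: 'a::pseudocomp_distrib_lattice)"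
  using le_pcomp_pcomp[of top] by (simp add: top.extremum_unique)

lemma inf_sup_eq_bot:
  fixes a :: "'a::pseudocomp_distrib_lattice"
  shows "inf a (sup b c) = bot \<longleftrightarrow> inf a b = bot \<and> inf a c = bot"
  by (simp add: inf_sup_distrib1)

lemma eq_bot_if_split:
  fixes w :: "'a::pseudocomp_distrib_lattice"
  assumes "inf w b = bot" "inf w (pcomp b) = bot"
  shows "w = bot"
  using assms by (metis inf.absorb1 le_pcomp_iff)

text \<open>Meets of the elements \<open>x\<^sub>i\<close> and their pseudocomplements are jointly dense: since
  \<open>b \<squnion> \<not>b\<close> is dense, an element can be split along one \<open>x\<^sub>i\<close> after another without losing
  the information that it is nonzero.\<close>

lemma eq_bot_if_all_split:
  fixes x :: "'i \<Rightarrow> 'a::pseudocomp_distrib_lattice"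
  assumes "finite I"
    and "\<And>T u. T \<subseteq> I \<Longrightarrow> u \<le> w \<Longrightarrow> \<forall>i\<in>T. u \<le> x i \<Longrightarrow> \<forall>i\<in>I - T. u \<le> pcomp (x i) \<Longrightarrow> u = bot"
  shows "w = bot"
  using assms
proof (induction I arbitrary: w rule: finite_induct)
  case empty
  show ?case using empty.prems[of "{}" w] by simp
next
  case (insert i I)
  have "inf w (x i) = bot"
  proof (rule insert.IH)
    fix T u assume T: "T \<subseteq> I" and u: "u \<le> inf w (x i)" "\<forall>j\<in>T. u \<le> x j" "\<forall>j\<in>I - T. u \<le> pcomp (x j)"
    show "u = bot"
      by (rule insert.prems[of "insert i T"]) (use T u in auto)
  qed
  moreover have "inf w (pcomp (x i)) = bot"
  proof (rule insert.IH)
    fix T u assume T: "T \<subseteq> I"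
      and u: "u \<le> inf w (pcomp (x i))" "\<forall>j\<in>T. u \<le> x j" "\<forall>j\<in>I - T. u \<le> pcomp (x j)"
    show "u = bot"
      by (rule insert.prems[of T]) (use T u in auto)
  qed
  ultimately show ?case by (rule eq_bot_if_split)
qed


section \<open>Join-irreducible elements, atoms and prime filters\<close>

text \<open>In a distributive lattice join-irreducible and join-prime elements coincide; the join-prime
  form is the one that prime filters provide.\<close>

definition jirr_in :: "'a::pseudocomp_distrib_lattice set \<Rightarrow> 'a \<Rightarrow> bool" where
  "jirr_in B j \<longleftrightarrow> j \<in> B \<and> j \<noteq> bot \<and> (\<forall>a\<in>B. \<forall>b\<in>B. j \<le> sup a b \<longrightarrow> j \<le> a \<or> j \<le> b)"

definition atom_in :: "'a::pseudocomp_distrib_lattice set \<Rightarrow> 'a \<Rightarrow> bool" where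
  "atom_in B a \<longleftrightarrow> a \<in> B \<and> a \<noteq> bot \<and> (\<forall>b\<in>B. inf a b = bot \<or> a \<le> b)"

definition atoms_below :: "'a::pseudocomp_distrib_lattice set \<Rightarrow> 'a \<Rightarrow> 'a set" where
  "atoms_below B x = {a. atom_in B a \<and> a \<le> x}"

definition upset_in :: "'a::pseudocomp_distrib_lattice set \<Rightarrow> 'a \<Rightarrow> 'a set" where
  "upset_in B j = {b \<in> B. j \<le> b}"

lemma subalgebra_inf: "subalgebra B \<Longrightarrow> a \<in> B \<Longrightarrow> b \<in> B \<Longrightarrow> inf a b \<in> B"
  and subalgebra_sup: "subalgebra B \<Longrightarrow> a \<in> B \<Longrightarrow> b \<in> B \<Longrightarrow> sup a b \<in> B"
  and subalgebra_pcomp: "subalgebra B \<Longrightarrow> a \<in> B \<Longrightarrow> pcomp a \<in> B"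
  and subalgebra_bot: "subalgebra B \<Longrightarrow> bot \<in> B"
  and subalgebra_top: "subalgebra B \<Longrightarrow> top \<in> B"
  unfolding subalgebra_def by blast+

lemma jirr_in_mem: "jirr_in B j \<Longrightarrow> j \<in> B"
  by (simp add: jirr_in_def)

lemma atom_in_imp_jirr_in: "atom_in B a \<Longrightarrow> jirr_in B a"
  unfolding atom_in_def jirr_in_def by (metis inf.absorb1 inf_sup_eq_bot)

lemma atom_in_eq:
  assumes "atom_in B a" "atom_in B b" "a \<le> b"
  shows "a = b"
  using assms unfolding atom_in_def by (metis inf.absorb2 order.antisym)

lemma ex_atom_below:
  assumes "finite B" "subalgebra B" "b \<in> B" "b \<noteq> bot"
  obtains a where "a \<in> atoms_below B b"
proof -
  have "finite (B - {bot})" "b \<in> B - {bot}" using assms by simp_all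
  from finite_has_minimal2[OF this] obtain m
    where m: "m \<in> B - {bot}" "m \<le> b" "\<And>d. d \<in> B - {bot} \<Longrightarrow> d \<le> m \<Longrightarrow> d = m"
    by blast
  have "inf m d = bot \<or> m \<le> d" if "d \<in> B" for d
  proof -
    have "inf m d \<in> B" using subalgebra_inf[OF assms(2)] m(1) that by blast
    then have "inf m d = bot \<or> inf m d = m" using m(3)[of "inf m d"] by auto
    then show ?thesis by (metis inf_le2)
  qed
  with m(1,2) have "m \<in> atoms_below B b" unfolding atoms_below_def atom_in_def by blast
  then show thesis by (rule that)
qed

text \<open>In a finite algebra the join-irreducible elements separate: an element that is minimal among
  those below \<open>b\<close> but not below \<open>c\<close> is join-irreducible.\<close>

lemma ex_jirr_in_separating:
  assumes "finite B" "subalgebra B" "b \<in> B" "\<not> b \<le> c"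
  obtains j where "jirr_in B j" "j \<le> b" "\<not> j \<le> c"
proof -
  have "finite {d \<in> B. \<not> d \<le> c}" "b \<in> {d \<in> B. \<not> d \<le> c}" using assms by simp_all
  from finite_has_minimal2[OF this] obtain m
    where m': "m \<in> {d \<in> B. \<not> d \<le> c}" and m_le: "m \<le> b"
      and m_min: "\<And>d. d \<in> {d \<in> B. \<not> d \<le> c} \<Longrightarrow> d \<le> m \<Longrightarrow> d = m"
    by blast
  from m' have m: "m \<in> B" "\<not> m \<le> c" by blast+
  have "m \<le> x \<or> m \<le> y" if "x \<in> B" "y \<in> B" "m \<le> sup x y" for x y
  proof (rule ccontr)
    assume "\<not> (m \<le> x \<or> m \<le> y)"
    then have "inf m x \<noteq> m" "inf m y \<noteq> m" by (simp_all add: inf.absorb_iff1)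
    then have "inf m x \<le> c" "inf m y \<le> c"
      using m_min[of "inf m x"] m_min[of "inf m y"] subalgebra_inf[OF assms(2) m(1)] that(1,2)
      by auto
    then have "inf m (sup x y) \<le> c" by (simp add: inf_sup_distrib1)
    with that(3) m(2) show False by (simp add: inf.absorb1)
  qed
  moreover have "m \<noteq> bot" using m(2) by auto
  ultimately have "jirr_in B m" using m(1) by (simp add: jirr_in_def)
  then show thesis using m_le m(2) by (rule that)
qed

lemma upset_in_subset_iff:
  assumes "k \<in> B"
  shows "upset_in B k \<subseteq> upset_in B j \<longleftrightarrow> j \<le> k"
  using assms unfolding upset_in_def by force

lemma inj_on_upset_in: "inj_on (upset_in B) {j. jirr_in B j}"
  by (rule inj_onI) (metis mem_Collect_eq jirr_in_mem order.antisym subset_refl upset_in_subset_iff)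

lemma prime_filter_upset_in:
  assumes "subalgebra B" "jirr_in B j"
  shows "prime_filter B (upset_in B j)"
proof -
  have "bot \<in> B - upset_in B j"
    using assms subalgebra_bot by (auto simp: upset_in_def jirr_in_def bot.extremum_unique)
  moreover have "j \<in> upset_in B j" using assms by (auto simp: upset_in_def jirr_in_def)
  ultimately show ?thesis
    using assms unfolding prime_filter_def upset_in_def jirr_in_def
    by (auto intro: subalgebra_inf)
qed

text \<open>A prime filter of a finite algebra is principal, and its least element is join-prime.\<close>

lemma dual_poset_eq:
  assumes "finite B" "subalgebra B"
  shows "dual_poset B = upset_in B ` {j. jirr_in B j}"
proof
  show "dual_poset B \<subseteq> upset_in B ` {j. jirr_in B j}"
  proof
    fix F assume "F \<in> dual_poset B"
    then have F: "prime_filter B F" by (simp add: dual_poset_def)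
    then have FB: "F \<subseteq> B" "F \<noteq> {}" "F \<noteq> B"
      and up: "\<And>a b. a \<in> F \<Longrightarrow> b \<in> B \<Longrightarrow> a \<le> b \<Longrightarrow> b \<in> F"
      and meet: "\<And>a b. a \<in> F \<Longrightarrow> b \<in> F \<Longrightarrow> inf a b \<in> F"
      and prime: "\<And>a b. a \<in> B \<Longrightarrow> b \<in> B \<Longrightarrow> sup a b \<in> F \<Longrightarrow> a \<in> F \<or> b \<in> F"
      unfolding prime_filter_def by blast+
    obtain j where j: "j \<in> F" "\<And>d. d \<in> F \<Longrightarrow> d \<le> j \<Longrightarrow> d = j"
      using finite_has_minimal[of F] FB assms(1) finite_subset by metis
    have le: "j \<le> b" if "b \<in> F" for b
      using j(2)[of "inf j b"] meet[OF j(1) that] by (metis inf_le1 inf_le2)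
    have F_eq: "F = upset_in B j"
      using le up[OF j(1)] FB(1) by (auto simp: upset_in_def)
    have "j \<noteq> bot"
      using FB(3) F_eq by (auto simp: upset_in_def)
    then have "jirr_in B j"
      using j(1) FB(1) prime up le subalgebra_sup[OF assms(2)] unfolding jirr_in_def by (metis subsetD)
    with F_eq show "F \<in> upset_in B ` {j. jirr_in B j}" by blast
  qed
  show "upset_in B ` {j. jirr_in B j} \<subseteq> dual_poset B"
    using prime_filter_upset_in[OF assms(2)] by (auto simp: dual_poset_def)
qed

lemma max_elems_upset_in:
  assumes "finite B" "subalgebra B"
  shows "max_elems (upset_in B ` {k. jirr_in B k \<and> k \<le> j}) = upset_in B ` atoms_below B j"
proof
  show "max_elems (upset_in B ` {k. jirr_in B k \<and> k \<le> j}) \<subseteq> upset_in B ` atoms_below B j"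
  proof
    fix F assume F: "F \<in> max_elems (upset_in B ` {k. jirr_in B k \<and> k \<le> j})"
    then obtain k where k: "jirr_in B k" "k \<le> j" "F = upset_in B k"
      by (auto simp: max_elems_def)
    obtain a where a: "a \<in> atoms_below B k"
      using ex_atom_below[OF assms, of k] k(1) by (auto simp: jirr_in_def)
    then have "jirr_in B a" "a \<le> j" "F \<le> upset_in B a"
      using atom_in_imp_jirr_in k by (auto simp: atoms_below_def upset_in_def)
    with F have "upset_in B a = F" unfolding max_elems_def by blast
    with a k(2) show "F \<in> upset_in B ` atoms_below B j"
      by (force simp: atoms_below_def)
  qed
  show "upset_in B ` atoms_below B j \<subseteq> max_elems (upset_in B ` {k. jirr_in B k \<and> k \<le> j})"
  proof
    fix F assume "F \<in> upset_in B ` atoms_below B j"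
    then obtain a where a: "atom_in B a" "a \<le> j" "F = upset_in B a"
      by (auto simp: atoms_below_def)
    have "upset_in B k = F" if "jirr_in B k" "F \<le> upset_in B k" for k
    proof -
      have "k \<le> a"
        using that(2) a upset_in_subset_iff[of a B k] by (simp add: atom_in_def)
      then have "a = k"
        using that(1) a(1) unfolding atom_in_def jirr_in_def by (metis inf.absorb2 order.antisym)
      with a show ?thesis by simp
    qed
    with a show "F \<in> max_elems (upset_in B ` {k. jirr_in B k \<and> k \<le> j})"
      using atom_in_imp_jirr_in unfolding max_elems_def by blast
  qed
qed


section \<open>Free skeletons of finite algebras\<close>

text \<open>A free skeleton of the dual poset, read through the order-reversing bijection between
  prime filters and join-irreducible elements: maximal prime filters become atoms and the least
  prime filter becomes the top element.\<close>

definition lattice_skeleton ::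
  "'a::pseudocomp_distrib_lattice set \<Rightarrow> ('a \<Rightarrow> 'a set \<Rightarrow> 'a) \<Rightarrow> bool" where
  "lattice_skeleton B s \<longleftrightarrow> jirr_in B top \<and>
     (\<forall>x Y. jirr_in B x \<and> Y \<noteq> {} \<and> Y \<subseteq> atoms_below B x \<longrightarrow>
        jirr_in B (s x Y) \<and> s x Y \<le> x \<and> atoms_below B (s x Y) = Y) \<and>
     (\<forall>x Y Z. jirr_in B x \<and> Y \<noteq> {} \<and> Y \<subseteq> Z \<and> Z \<subseteq> atoms_below B x \<longrightarrow> s x Y \<le> s x Z) \<and>
     (\<forall>x Y. jirr_in B x \<and> Y \<noteq> {} \<and> Y \<subseteq> atoms_below B top \<and> atoms_below B x \<subseteq> Y \<longrightarrow>
        x \<le> s top Y)"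

lemma has_free_skeleton_iff:
  assumes "finite B" "subalgebra B"
  shows "has_free_skeleton (dual_poset B) \<longleftrightarrow> (\<exists>s. lattice_skeleton B s)"
proof -
  let ?J = "{j. jirr_in B j}" and ?X = "dual_poset B"
  let ?u = "upset_in B"
  define g where "g = inv_into ?J ?u"
  have g_u: "g (?u j) = j" if "jirr_in B j" for j
    using that inj_on_upset_in[of B] by (simp add: g_def inv_into_f_f)
  have g_u_image: "g ` (?u ` Y) = Y" if "Y \<subseteq> atoms_below B x" for Y x
  proof -
    have "g (?u y) = y" if "y \<in> Y" for y
      using g_u atom_in_imp_jirr_in \<open>Y \<subseteq> atoms_below B x\<close> that by (auto simp: atoms_below_def)
    then show ?thesis by (simp add: image_image)
  qed
  have X: "?X = ?u ` ?J" by (rule dual_poset_eq[OF assms])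
  have le: "?u k \<le> ?u j \<longleftrightarrow> j \<le> k" if "jirr_in B k" for j k
    using that upset_in_subset_iff jirr_in_mem by blast
  have up_eq: "up ?X (?u j) = ?u ` {k. jirr_in B k \<and> k \<le> j}" if "jirr_in B j" for j
    unfolding up_def X using le[OF that] by blast
  have max_up: "max_elems (up ?X (?u j)) = ?u ` atoms_below B j" if "jirr_in B j" for j
    unfolding up_eq[OF that] by (rule max_elems_upset_in[OF assms])
  have max_X: "max_elems ?X = ?u ` atoms_below B top"
    using max_elems_upset_in[OF assms, of top] by (simp add: X)
  have atoms_J: "atoms_below B x \<subseteq> ?J" for x
    using atom_in_imp_jirr_in by (auto simp: atoms_below_def)
  have u_image_subset: "Y \<subseteq> Z" if "Y \<subseteq> ?J" "Z \<subseteq> ?J" "?u ` Y \<subseteq> ?u ` Z" for Y Z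
  proof
    fix y assume "y \<in> Y"
    then have "?u y \<in> ?u ` Z" "y \<in> ?J" using that by blast+
    then show "y \<in> Z" using inj_on_image_mem_iff[OF inj_on_upset_in _ that(2)] by blast
  qed
  show ?thesis
  proof
    assume "has_free_skeleton ?X"
    then obtain b s where b: "b \<in> ?X" "\<forall>x\<in>?X. b \<le> x"
      and s1: "\<forall>x\<in>?X. \<forall>Y. Y \<noteq> {} \<and> Y \<subseteq> max_elems (up ?X x) \<longrightarrow>
             s x Y \<in> up ?X x \<and> Y = max_elems (up ?X (s x Y))"
      and s2: "\<forall>x\<in>?X. \<forall>Y Z. Y \<noteq> {} \<and> Z \<noteq> {} \<and> Y \<subseteq> max_elems (up ?X x) \<and>
             Z \<subseteq> max_elems (up ?X x) \<and> Y \<subseteq> Z \<longrightarrow> s x Z \<le> s x Y"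
      and s3: "\<forall>x\<in>?X. \<forall>Y. Y \<noteq> {} \<and> Y \<subseteq> max_elems ?X \<and> max_elems (up ?X x) \<subseteq> Y \<longrightarrow>
             s b Y \<le> x"
      unfolding has_free_skeleton_def by (elim bexE conjE exE)
    obtain j0 where j0: "jirr_in B j0" "b = ?u j0" using b(1) X by blast
    have j0_max: "k \<le> j0" if "jirr_in B k" for k
      using bspec[OF b(2), of "?u k"] that X le[OF j0(1), of k] j0(2) by simp
    have "top \<le> j0"
      using ex_jirr_in_separating[OF assms subalgebra_top[OF assms(2)], of j0] j0_max by blast
    then have top: "jirr_in B top" "b = ?u top"
      using j0 by (simp_all add: top.extremum_unique)
    define s' where "s' x Y = g (s (?u x) (?u ` Y))" for x Y
    have s'_1: "jirr_in B (s' x Y) \<and> ?u (s' x Y) = s (?u x) (?u ` Y) \<and> s' x Y \<le> x \<and>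
        atoms_below B (s' x Y) = Y"
      if "jirr_in B x" "Y \<noteq> {}" "Y \<subseteq> atoms_below B x" for x Y
    proof -
      have *: "s (?u x) (?u ` Y) \<in> up ?X (?u x)"
        "?u ` Y = max_elems (up ?X (s (?u x) (?u ` Y)))"
        using s1 that max_up X by (simp_all add: image_mono)
      with up_eq[OF that(1)] have "s (?u x) (?u ` Y) \<in> ?u ` {k. jirr_in B k \<and> k \<le> x}"
        by simp
      then obtain k where k: "jirr_in B k" "k \<le> x" "s (?u x) (?u ` Y) = ?u k"
        by blast
      have "s' x Y = k" unfolding s'_def k(3) using k(1) by (rule g_u)
      moreover have "?u ` Y = ?u ` atoms_below B k"
        using *(2) unfolding k(3) max_up[OF k(1)] .
      then have "Y = atoms_below B k"
        by (rule iffD1[OF inj_on_image_eq_iff[OF inj_on_upset_in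
                subset_trans[OF that(3) atoms_J] atoms_J]])
      ultimately show ?thesis using k by simp
    qed
    have s'_2: "s' x Y \<le> s' x Z"
      if "jirr_in B x" "Y \<noteq> {}" "Y \<subseteq> Z" "Z \<subseteq> atoms_below B x" for x Y Z
    proof -
      have Y: "Y \<subseteq> atoms_below B x" and Z: "Z \<noteq> {}" using that by blast+
      have "s (?u x) (?u ` Z) \<le> s (?u x) (?u ` Y)"
        using s2 that Y Z X max_up[OF that(1)] by (simp add: image_mono)
      then show ?thesis
        using le[of "s' x Z" "s' x Y"] s'_1[OF that(1,2) Y] s'_1[OF that(1) Z that(4)] by metis
    qed
    have s'_3: "x \<le> s' top Y"
      if "jirr_in B x" "Y \<noteq> {}" "Y \<subseteq> atoms_below B top" "atoms_below B x \<subseteq> Y" for x Y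
    proof -
      have "s b (?u ` Y) \<le> ?u x"
        using s3 that X max_up[OF that(1)] max_X by (simp add: image_mono)
      then show ?thesis
        using le[of "s' top Y" x] s'_1[OF top(1) that(2,3)] top(2) by metis
    qed
    have "lattice_skeleton B s'"
      unfolding lattice_skeleton_def using top(1) s'_1 s'_2 s'_3 by (intro conjI allI impI) simp_all
    then show "\<exists>s. lattice_skeleton B s" by blast
  next
    assume "\<exists>s. lattice_skeleton B s"
    then obtain s where skel: "lattice_skeleton B s" ..
    have top: "jirr_in B top"
      and s1: "\<And>x Y. jirr_in B x \<Longrightarrow> Y \<noteq> {} \<Longrightarrow> Y \<subseteq> atoms_below B x \<Longrightarrow>
        jirr_in B (s x Y) \<and> s x Y \<le> x \<and> atoms_below B (s x Y) = Y"
      and s2: "\<And>x Y Z. jirr_in B x \<Longrightarrow> Y \<noteq> {} \<Longrightarrow> Y \<subseteq> Z \<Longrightarrow> Z \<subseteq> atoms_below B x \<Longrightarrow> s x Y \<le> s x Z"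
      and s3: "\<And>x Y. jirr_in B x \<Longrightarrow> Y \<noteq> {} \<Longrightarrow> Y \<subseteq> atoms_below B top \<Longrightarrow> atoms_below B x \<subseteq> Y
        \<Longrightarrow> x \<le> s top Y"
      using skel unfolding lattice_skeleton_def by simp_all
    define s' where "s' F \<Y> = ?u (s (g F) (g ` \<Y>))" for F \<Y>
    have s'_u: "s' (?u x) (?u ` Y) = ?u (s x Y)" if "jirr_in B x" "Y \<subseteq> atoms_below B z" for x Y z
      unfolding s'_def g_u[OF that(1)] g_u_image[OF that(2)] ..
    have "?u top \<in> ?X" using top X by blast
    moreover have "?u top \<le> F" if "F \<in> ?X" for F
      using that X le[OF top] by auto
    moreover have "s' F \<Y> \<in> up ?X F \<and> \<Y> = max_elems (up ?X (s' F \<Y>))"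
      if "F \<in> ?X" "\<Y> \<noteq> {}" "\<Y> \<subseteq> max_elems (up ?X F)" for F \<Y>
    proof -
      obtain x where x: "jirr_in B x" "F = ?u x" using \<open>F \<in> ?X\<close> X by blast
      have "\<Y> \<subseteq> ?u ` atoms_below B x" using that(3) max_up[OF x(1)] x(2) by simp
      then obtain Y where Y: "Y \<subseteq> atoms_below B x" "\<Y> = ?u ` Y"
        unfolding subset_image_iff by blast
      have "Y \<noteq> {}" using Y that by blast
      note * = s1[OF x(1) this Y(1)]
      show ?thesis
        using * max_up[of "s x Y"] up_eq[OF x(1)] unfolding x(2) Y(2) s'_u[OF x(1) Y(1)] by auto
    qed
    moreover have "s' F \<Z> \<le> s' F \<Y>"
      if "F \<in> ?X" "\<Y> \<noteq> {}" "\<Z> \<noteq> {}" "\<Y> \<subseteq> max_elems (up ?X F)" "\<Z> \<subseteq> max_elems (up ?X F)"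
        "\<Y> \<subseteq> \<Z>" for F \<Y> \<Z>
    proof -
      obtain x where x: "jirr_in B x" "F = ?u x" using \<open>F \<in> ?X\<close> X by blast
      have "\<Z> \<subseteq> ?u ` atoms_below B x" using that(5) max_up[OF x(1)] x(2) by simp
      then obtain Z where Z: "Z \<subseteq> atoms_below B x" "\<Z> = ?u ` Z"
        unfolding subset_image_iff by blast
      have "\<Y> \<subseteq> ?u ` Z" using that(6) Z(2) by simp
      then obtain Y where Y: "Y \<subseteq> Z" "\<Y> = ?u ` Y"
        unfolding subset_image_iff by blast
      have YZ: "Y \<noteq> {}" "Z \<noteq> {}" "Y \<subseteq> atoms_below B x" using Y Z that by auto
      show ?thesis
        using s2[OF x(1) YZ(1) Y(1) Z(1)] le s1[OF x(1) YZ(2) Z(1)]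
        unfolding x(2) Y(2) Z(2) s'_u[OF x(1) YZ(3)] s'_u[OF x(1) Z(1)] by blast
    qed
    moreover have "s' (?u top) \<Y> \<le> F"
      if "F \<in> ?X" "\<Y> \<noteq> {}" "\<Y> \<subseteq> max_elems ?X" "max_elems (up ?X F) \<subseteq> \<Y>" for F \<Y>
    proof -
      obtain x where x: "jirr_in B x" "F = ?u x" using \<open>F \<in> ?X\<close> X by blast
      have "\<Y> \<subseteq> ?u ` atoms_below B top" using that(3) max_X by simp
      then obtain Y where Y: "Y \<subseteq> atoms_below B top" "\<Y> = ?u ` Y"
        unfolding subset_image_iff by blast
      have Y0: "Y \<noteq> {}" using Y that by auto
      have "?u ` atoms_below B x \<subseteq> ?u ` Y" using that(4) max_up x Y by simp
      then have "atoms_below B x \<subseteq> Y"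
        using u_image_subset[of "atoms_below B x" Y] atoms_J[of x] atoms_J[of top] Y(1)
        by (meson subset_trans)
      then show ?thesis
        using s3[OF x(1) Y0 Y(1)] le s1[OF top Y0 Y(1)]
        unfolding x(2) Y(2) s'_u[OF top Y(1)] by blast
    qed
    ultimately show "has_free_skeleton ?X"
      unfolding has_free_skeleton_def
      by (intro bexI[of _ "?u top"] conjI exI[of _ s'] ballI allI impI) simp_all
  qed
qed


section \<open>Indexed connectives and universal closures\<close>

lemma set_list_of: "finite I \<Longrightarrow> set (list_of I) = I"
  unfolding list_of_def by (rule someI2_ex) (use finite_distinct_list in auto)

lemma le_eval_BigMeet:
  assumes "finite I"
  shows "u \<le> eval v (BigMeet I t) \<longleftrightarrow> (\<forall>i\<in>I. u \<le> eval v (t i))"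
proof -
  have "u \<le> eval v (foldr (\<lambda>i. Meet (t i)) xs OneT) \<longleftrightarrow> (\<forall>i\<in>set xs. u \<le> eval v (t i))" for xs
    by (induction xs) auto
  then show ?thesis by (simp add: BigMeet_def set_list_of[OF assms])
qed

lemma eval_BigJoin_le:
  assumes "finite I"
  shows "eval v (BigJoin I t) \<le> u \<longleftrightarrow> (\<forall>i\<in>I. eval v (t i) \<le> u)"
proof -
  have "eval v (foldr (\<lambda>i. Join (t i)) xs ZeroT) \<le> u \<longleftrightarrow> (\<forall>i\<in>set xs. eval v (t i) \<le> u)" for xs
    by (induction xs) auto
  then show ?thesis by (simp add: BigJoin_def set_list_of[OF assms])
qed

lemma inf_eval_BigJoin_eq_bot:
  assumes "finite I"
  shows "inf u (eval v (BigJoin I t)) = bot \<longleftrightarrow> (\<forall>i\<in>I. inf u (eval v (t i)) = bot)"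
proof -
  have "inf u (eval v (foldr (\<lambda>i. Join (t i)) xs ZeroT)) = bot \<longleftrightarrow>
      (\<forall>i\<in>set xs. inf u (eval v (t i)) = bot)" for xs
    by (induction xs) (auto simp: inf_sup_eq_bot)
  then show ?thesis by (simp add: BigJoin_def set_list_of[OF assms])
qed

lemma eval_BigMeet_in:
  assumes "finite I" "subalgebra B" "\<And>i. i \<in> I \<Longrightarrow> eval v (t i) \<in> B"
  shows "eval v (BigMeet I t) \<in> B"
proof -
  have "eval v (foldr (\<lambda>i. Meet (t i)) xs OneT) \<in> B" if "set xs \<subseteq> I" for xs
    using that by (induction xs) (auto intro: subalgebra_inf[OF assms(2)] assms(3)
        subalgebra_top[OF assms(2)])
  then show ?thesis by (simp add: BigMeet_def set_list_of[OF assms(1)])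
qed

lemma eval_BigJoin_in:
  assumes "finite I" "subalgebra B" "\<And>i. i \<in> I \<Longrightarrow> eval v (t i) \<in> B"
  shows "eval v (BigJoin I t) \<in> B"
proof -
  have "eval v (foldr (\<lambda>i. Join (t i)) xs ZeroT) \<in> B" if "set xs \<subseteq> I" for xs
    using that by (induction xs) (auto intro: subalgebra_sup[OF assms(2)] assms(3)
        subalgebra_bot[OF assms(2)])
  then show ?thesis by (simp add: BigJoin_def set_list_of[OF assms(1)])
qed

lemma jirr_in_le_BigJoin:
  assumes "finite I" "subalgebra B" "\<And>i. i \<in> I \<Longrightarrow> eval v (t i) \<in> B"
    and "jirr_in B j" "j \<le> eval v (BigJoin I t)"
  shows "\<exists>i\<in>I. j \<le> eval v (t i)"
proof -
  have "eval v (foldr (\<lambda>i. Join (t i)) xs ZeroT) \<in> B \<and>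
      (j \<le> eval v (foldr (\<lambda>i. Join (t i)) xs ZeroT) \<longrightarrow> (\<exists>i\<in>set xs. j \<le> eval v (t i)))"
    if "set xs \<subseteq> I" for xs
    using that
  proof (induction xs)
    case Nil
    then show ?case
      using assms(4) subalgebra_bot[OF assms(2)] by (simp add: jirr_in_def bot.extremum_unique)
  next
    case (Cons i xs)
    then show ?case
      using assms(3)[of i] assms(4) subalgebra_sup[OF assms(2)] by (auto simp: jirr_in_def)
  qed
  then show ?thesis
    using assms(5) by (metis BigJoin_def order_refl set_list_of[OF assms(1)])
qed

lemma sat_BigAnd: "finite I \<Longrightarrow> sat_fm v (BigAnd I \<phi>) \<longleftrightarrow> (\<forall>i\<in>I. sat_fm v (\<phi> i))"
proof -
  have "sat_fm v (foldr (\<lambda>i. FAnd (\<phi> i)) xs FTrue) \<longleftrightarrow> (\<forall>i\<in>set xs. sat_fm v (\<phi> i))" for xs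
    by (induction xs) auto
  then show "finite I \<Longrightarrow> ?thesis" by (simp add: BigAnd_def set_list_of)
qed

lemma sat_BigOr: "finite I \<Longrightarrow> sat_fm v (BigOr I \<phi>) \<longleftrightarrow> (\<exists>i\<in>I. sat_fm v (\<phi> i))"
proof -
  have "sat_fm v (foldr (\<lambda>i. FOr (\<phi> i)) xs FFalse) \<longleftrightarrow> (\<exists>i\<in>set xs. sat_fm v (\<phi> i))" for xs
    by (induction xs) auto
  then show "finite I \<Longrightarrow> ?thesis" by (simp add: BigOr_def set_list_of)
qed

lemma eval_subst_trm: "eval v (subst_trm \<sigma> t) = eval (\<lambda>i. eval v (\<sigma> i)) t"
  by (induction t) auto

lemma sat_subst_fm: "sat_fm v (subst_fm \<sigma> \<phi>) \<longleftrightarrow> sat_fm (\<lambda>i. eval v (\<sigma> i)) \<phi>"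
  by (induction \<phi>) (auto simp: eval_subst_trm)

lemma sat_univ_closure:
  "(\<forall>v :: nat \<Rightarrow> 'a::pseudocomp_distrib_lattice. sat_ufm v (univ_closure \<phi>)) \<longleftrightarrow>
   (\<forall>v :: nat \<Rightarrow> 'a. sat_fm v \<phi>)"
proof -
  have "(\<forall>v :: nat \<Rightarrow> 'a. sat_ufm v (foldr All xs (QF \<phi>))) \<longleftrightarrow> (\<forall>v :: nat \<Rightarrow> 'a. sat_fm v \<phi>)" for xs
  proof (induction xs)
    case (Cons i xs)
    have "(\<forall>v :: nat \<Rightarrow> 'a. sat_ufm v (All i \<Phi>)) \<longleftrightarrow> (\<forall>v :: nat \<Rightarrow> 'a. sat_ufm v \<Phi>)" for \<Phi>
      by simp (metis fun_upd_triv)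
    with Cons show ?case by simp
  qed simp
  then show ?thesis by (simp add: univ_closure_def)
qed


section \<open>The subalgebra generated by finitely many elements\<close>

lemma le_eval_a_trm:
  assumes "T \<subseteq> {1..n}"
  shows "u \<le> eval v (a_trm n T) \<longleftrightarrow> (\<forall>i\<in>T. u \<le> v i) \<and> (\<forall>i\<in>{1..n} - T. u \<le> pcomp (v i))"
  using assms by (simp add: a_trm_def le_eval_BigMeet finite_subset)

lemma eval_a_trm_cases:
  assumes "T \<subseteq> {1..n}" "i \<in> {1..n}"
  shows "if i \<in> T then eval v (a_trm n T) \<le> v i else eval v (a_trm n T) \<le> pcomp (v i)"
  using assms le_eval_a_trm[OF assms(1), of "eval v (a_trm n T)" v] by auto

lemma eval_a_trm_disjoint:
  assumes "T \<subseteq> {1..n}" "U \<subseteq> {1..n}" "T \<noteq> U"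
  shows "inf (eval v (a_trm n T)) (eval v (a_trm n U)) = bot"
proof -
  obtain i where i: "i \<in> {1..n}" "i \<in> T \<longleftrightarrow> i \<notin> U" using assms by blast
  show ?thesis
    using eval_a_trm_cases[OF assms(1) i(1), of v] eval_a_trm_cases[OF assms(2) i(1), of v] i(2)
      inf_eq_bot_mono[OF inf_pcomp[of "v i"]] by (metis inf_commute)
qed

lemma eq_bot_if_disjoint_a_trm:
  assumes "\<And>T. T \<subseteq> {1..n} \<Longrightarrow> inf w (eval v (a_trm n T)) = bot"
  shows "w = bot"
proof (rule eq_bot_if_all_split[where I = "{1..n}" and x = v])
  fix T u assume "T \<subseteq> {1..n}" "u \<le> w" "\<forall>i\<in>T. u \<le> v i" "\<forall>i\<in>{1..n} - T. u \<le> pcomp (v i)"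
  then have "u \<le> inf w (eval v (a_trm n T))" by (simp add: le_eval_a_trm)
  with assms \<open>T \<subseteq> {1..n}\<close> show "u = bot" by (simp add: bot.extremum_unique)
qed simp

text \<open>The index set of the terms \<open>p\<close>, but with \<open>L = {}\<close> admitted. With nonempty \<open>L\<close> alone
  the values of the \<open>p\<close> need not generate the subalgebra under joins: they all lie
  below the join of the generators.\<close>

definition shapes :: "nat \<Rightarrow> (nat set \<times> nat set set) set" where
  "shapes n = {(L, \<T>). L \<subseteq> {1..n} \<and> \<T> \<subseteq> Pow {1..n} \<and> L \<subseteq> \<Inter>\<T>}"

lemma S_set_eq: "S_set n = {c \<in> shapes n. fst c \<noteq> {}}"
  by (auto simp: S_set_def shapes_def)

lemma finite_shapes: "finite (shapes n)"
  by (rule finite_subset[of _ "Pow {1..n} \<times> Pow (Pow {1..n})"]) (auto simp: shapes_def)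

lemma finite_S_set: "finite (S_set n)"
  by (simp add: S_set_eq finite_shapes)

text \<open>The elements \<open>a\<^sub>T\<close> are pairwise disjoint with dense join, so the regular element
  \<open>\<not>\<not>\<Squnion>\<T>\<close> is the largest element disjoint from all \<open>a\<^sub>T\<close> with \<open>T \<notin> \<T>\<close>. This
  description reduces every identity about the terms \<open>p\<close> to a comparison of index sets.\<close>

lemma le_eval_p_trm:
  assumes "c \<in> shapes n"
  shows "u \<le> eval v (p_trm n c) \<longleftrightarrow>
    (\<forall>i\<in>fst c. u \<le> v i) \<and> (\<forall>T. T \<subseteq> {1..n} \<and> T \<notin> snd c \<longrightarrow> inf u (eval v (a_trm n T)) = bot)"
proof -
  let ?a = "\<lambda>T. eval v (a_trm n T)" and ?b = "eval v (BigJoin (snd c) (a_trm n))"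
  have c: "fst c \<subseteq> {1..n}" "snd c \<subseteq> Pow {1..n}" using assms by (auto simp: shapes_def)
  then have fin: "finite (fst c)" "finite (snd c)" by (simp_all add: finite_subset)
  have a_le: "?a T \<le> ?b" if "T \<in> snd c" for T
    using that eval_BigJoin_le[OF fin(2), of v "a_trm n" ?b] by simp
  have a_disj: "?a T \<le> pcomp ?b" if "T \<subseteq> {1..n}" "T \<notin> snd c" for T
    unfolding le_pcomp_iff inf_eval_BigJoin_eq_bot[OF fin(2)]
    using that c(2) eval_a_trm_disjoint[of T n] by blast
  have "u \<le> pcomp (pcomp ?b) \<longleftrightarrow> (\<forall>T. T \<subseteq> {1..n} \<and> T \<notin> snd c \<longrightarrow> inf u (?a T) = bot)"
  proof
    assume u: "u \<le> pcomp (pcomp ?b)"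
    show "\<forall>T. T \<subseteq> {1..n} \<and> T \<notin> snd c \<longrightarrow> inf u (?a T) = bot"
      using a_disj inf_eq_bot_mono[OF inf_pcomp[of "pcomp ?b", unfolded inf_commute[of "pcomp ?b"]] u]
      by blast
  next
    assume *: "\<forall>T. T \<subseteq> {1..n} \<and> T \<notin> snd c \<longrightarrow> inf u (?a T) = bot"
    have "inf u (pcomp ?b) = bot"
    proof (rule eq_bot_if_disjoint_a_trm[of n _ v])
      fix T :: "nat set" assume T: "T \<subseteq> {1..n}"
      show "inf (inf u (pcomp ?b)) (?a T) = bot"
      proof (cases "T \<in> snd c")
        case True
        then show ?thesis
          using inf_eq_bot_mono[OF inf_pcomp[of ?b, unfolded inf_commute[of ?b]] inf_le2 a_le] by blast
      next
        case False
        then have "inf u (?a T) = bot" using * T by blast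
        then show ?thesis by (rule inf_eq_bot_mono) simp_all
      qed
    qed
    then show "u \<le> pcomp (pcomp ?b)" by (simp add: le_pcomp_iff)
  qed
  then show ?thesis by (simp add: p_trm_def le_eval_BigMeet[OF fin(1)])
qed

lemma eq_if_same_lower_bounds:
  fixes a :: "'a::order"
  assumes "\<And>u. u \<le> a \<longleftrightarrow> u \<le> b"
  shows "a = b"
  using assms[of a] assms[of b] by simp

definition meet_shape ::
  "nat set \<times> nat set set \<Rightarrow> nat set \<times> nat set set \<Rightarrow> nat set \<times> nat set set" where
  "meet_shape c d = (fst c \<union> fst d, snd c \<inter> snd d)"

lemma meet_shape_in_shapes: "c \<in> shapes n \<Longrightarrow> d \<in> shapes n \<Longrightarrow> meet_shape c d \<in> shapes n"
  by (auto simp: shapes_def meet_shape_def)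

lemma eval_p_trm_meet_shape:
  assumes "c \<in> shapes n" "d \<in> shapes n"
  shows "eval v (p_trm n (meet_shape c d)) = inf (eval v (p_trm n c)) (eval v (p_trm n d))"
proof (rule eq_if_same_lower_bounds)
  fix u
  show "u \<le> eval v (p_trm n (meet_shape c d)) \<longleftrightarrow> u \<le> inf (eval v (p_trm n c)) (eval v (p_trm n d))"
    unfolding le_inf_iff le_eval_p_trm[OF meet_shape_in_shapes[OF assms]]
      le_eval_p_trm[OF assms(1)] le_eval_p_trm[OF assms(2)]
    by (auto simp: meet_shape_def)
qed

lemma eval_p_trm_mono:
  assumes "c \<in> shapes n" "d \<in> shapes n" "S_le c d"
  shows "eval v (p_trm n c) \<le> eval v (p_trm n d)"
proof -
  have "meet_shape c d = c" using assms(3) by (auto simp: meet_shape_def S_le_def prod_eq_iff)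
  then show ?thesis using eval_p_trm_meet_shape[OF assms(1,2), of v] by (simp add: inf.absorb_iff1)
qed

definition var_shape :: "nat \<Rightarrow> nat \<Rightarrow> nat set \<times> nat set set" where
  "var_shape n i = ({i}, {T. T \<subseteq> {1..n} \<and> i \<in> T})"

lemma var_shape_in_shapes: "i \<in> {1..n} \<Longrightarrow> var_shape n i \<in> shapes n"
  by (auto simp: shapes_def var_shape_def)

text \<open>A generator is itself one of the \<open>p\<close>: what lies below \<open>x\<^sub>i\<close> is disjoint from every \<open>a\<^sub>T\<close> with
  \<open>i \<notin> T\<close>.\<close>

lemma eval_p_trm_var_shape:
  assumes "i \<in> {1..n}"
  shows "eval v (p_trm n (var_shape n i)) = v i"
proof (rule eq_if_same_lower_bounds)
  fix u
  have "inf u (eval v (a_trm n T)) = bot" if "u \<le> v i" "T \<subseteq> {1..n}" "i \<notin> T" for T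
    using eval_a_trm_cases[OF that(2) assms, of v] that inf_eq_bot_mono[OF inf_pcomp that(1)] by simp
  then show "u \<le> eval v (p_trm n (var_shape n i)) \<longleftrightarrow> u \<le> v i"
    unfolding le_eval_p_trm[OF var_shape_in_shapes[OF assms]] by (auto simp: var_shape_def)
qed

inductive_set join_closure :: "'a::bounded_lattice set \<Rightarrow> 'a set" for G where
  join_closure_bot: "bot \<in> join_closure G"
| join_closure_step: "g \<in> G \<Longrightarrow> b \<in> join_closure G \<Longrightarrow> sup g b \<in> join_closure G"

lemma join_closure_base: "g \<in> G \<Longrightarrow> g \<in> join_closure G"
  using join_closure_step[OF _ join_closure_bot] by fastforce

lemma join_closure_sup: "a \<in> join_closure G \<Longrightarrow> b \<in> join_closure G \<Longrightarrow> sup a b \<in> join_closure G"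
  by (induction rule: join_closure.induct) (auto simp: sup_assoc intro: join_closure_step)

lemma join_closure_inf:
  fixes G :: "'a::pseudocomp_distrib_lattice set"
  assumes "\<And>g h. g \<in> G \<Longrightarrow> h \<in> G \<Longrightarrow> inf g h \<in> G"
    and "a \<in> join_closure G" "b \<in> join_closure G"
  shows "inf a b \<in> join_closure G"
proof -
  have "inf g b \<in> join_closure G" if "g \<in> G" for g
    using assms(3) that
    by (induction rule: join_closure.induct)
      (auto simp: inf_sup_distrib1 intro: join_closure_bot join_closure_step assms(1))
  with assms(2) show ?thesis
    by (induction rule: join_closure.induct)
      (auto simp: inf_sup_distrib2 intro: join_closure_bot join_closure_sup)
qed

lemma join_closure_subset:
  assumes "subalgebra B" "G \<subseteq> B"
  shows "join_closure G \<subseteq> B"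
proof
  fix b assume "b \<in> join_closure G"
  then show "b \<in> B"
    by (induction rule: join_closure.induct)
      (use assms in \<open>auto intro: subalgebra_bot subalgebra_sup\<close>)
qed

text \<open>A join of elements of \<open>G\<close> is determined by the elements of \<open>G\<close> below it.\<close>

lemma finite_join_closure:
  assumes "finite G"
  shows "finite (join_closure G)"
proof (rule inj_on_finite[where f = "\<lambda>b. {g \<in> G. g \<le> b}"])
  have least: "b \<le> u" if "b \<in> join_closure G" "\<forall>g\<in>G. g \<le> b \<longrightarrow> g \<le> u" for b u
    using that
  proof (induction rule: join_closure.induct)
    case (join_closure_step g b)
    have "g \<le> u" using join_closure_step.hyps(1) join_closure_step.prems by simp
    moreover have "b \<le> u"
      by (rule join_closure_step.IH) (use join_closure_step.prems in \<open>simp add: le_supI2\<close>)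
    ultimately show ?case by simp
  qed simp
  show "inj_on (\<lambda>b. {g \<in> G. g \<le> b}) (join_closure G)"
  proof (rule inj_onI)
    fix b c assume bc: "b \<in> join_closure G" "c \<in> join_closure G" "{g \<in> G. g \<le> b} = {g \<in> G. g \<le> c}"
    then have "g \<le> b \<longleftrightarrow> g \<le> c" if "g \<in> G" for g using that by blast
    then show "b = c" using least[OF bc(1), of c] least[OF bc(2), of b] by (simp add: order.antisym)
  qed
  show "(\<lambda>b. {g \<in> G. g \<le> b}) ` join_closure G \<subseteq> Pow G" by auto
qed (use assms in simp)

definition gen_alg :: "(nat \<Rightarrow> 'a::pseudocomp_distrib_lattice) \<Rightarrow> nat \<Rightarrow> 'a set" where
  "gen_alg v n = join_closure ((\<lambda>c. eval v (p_trm n c)) ` shapes n)"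

lemma finite_gen_alg: "finite (gen_alg v n)"
  by (simp add: gen_alg_def finite_join_closure finite_shapes)

lemma eval_p_trm_in_gen_alg: "c \<in> shapes n \<Longrightarrow> eval v (p_trm n c) \<in> gen_alg v n"
  by (simp add: gen_alg_def join_closure_base)

lemma var_in_gen_alg: "i \<in> {1..n} \<Longrightarrow> v i \<in> gen_alg v n"
  using eval_p_trm_in_gen_alg[OF var_shape_in_shapes, of i n v] by (simp add: eval_p_trm_var_shape)

lemma eval_a_trm_in_subalgebra:
  assumes "subalgebra B" "\<And>i. i \<in> {1..n} \<Longrightarrow> v i \<in> B" "T \<subseteq> {1..n}"
  shows "eval v (a_trm n T) \<in> B"
  unfolding a_trm_def eval.simps
  by (intro subalgebra_inf[OF assms(1)] eval_BigMeet_in[OF _ assms(1)])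
    (use assms in \<open>auto intro: finite_subset subalgebra_pcomp\<close>)

lemma gen_alg_least:
  assumes "subalgebra B" "\<And>i. i \<in> {1..n} \<Longrightarrow> v i \<in> B"
  shows "gen_alg v n \<subseteq> B"
  unfolding gen_alg_def
proof (rule join_closure_subset[OF assms(1)], rule image_subsetI)
  fix c assume "c \<in> shapes n"
  then have c: "fst c \<subseteq> {1..n}" "snd c \<subseteq> Pow {1..n}" by (auto simp: shapes_def)
  then have fin: "finite (fst c)" "finite (snd c)" by (simp_all add: finite_subset)
  have "eval v (a_trm n T) \<in> B" if "T \<in> snd c" for T
    by (rule eval_a_trm_in_subalgebra) (use assms c that in auto)
  moreover have "eval v (Var i) \<in> B" if "i \<in> fst c" for i
    using assms(2) c(1) that by (simp add: subset_iff)
  ultimately show "eval v (p_trm n c) \<in> B"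
    unfolding p_trm_def eval.simps
    by (intro subalgebra_inf[OF assms(1)] subalgebra_pcomp[OF assms(1)]
        eval_BigMeet_in[OF fin(1) assms(1)] eval_BigJoin_in[OF fin(2) assms(1)]) simp_all
qed

lemma subalgebra_decided_by:
  fixes a :: "'a::pseudocomp_distrib_lattice"
  shows "subalgebra {b. inf a b = bot \<or> a \<le> b}"
proof -
  have "inf a (inf b c) = bot \<or> a \<le> inf b c" if "inf a b = bot \<or> a \<le> b" "inf a c = bot \<or> a \<le> c" for b c
    using that inf_eq_bot_mono[OF _ order_refl] by (metis inf_le1 inf_le2 le_inf_iff)
  moreover have "inf a (sup b c) = bot \<or> a \<le> sup b c"
    if "inf a b = bot \<or> a \<le> b" "inf a c = bot \<or> a \<le> c" for b c
    using that by (auto simp: inf_sup_eq_bot intro: le_supI1 le_supI2)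
  moreover have "inf a (pcomp b) = bot \<or> a \<le> pcomp b" if "inf a b = bot \<or> a \<le> b" for b
    using that inf_eq_bot_mono[OF inf_pcomp, of a b "pcomp b"] by (auto simp: le_pcomp_iff)
  ultimately show ?thesis by (auto simp: subalgebra_def)
qed

text \<open>Each \<open>a\<^sub>T\<close> lies below every generator or is disjoint from it, and this property passes to
  all elements that the generators produce. So \<open>a\<^sub>T\<close> is zero or an atom of the generated
  subalgebra.\<close>

lemma gen_alg_decided:
  assumes "b \<in> gen_alg v n" "T \<subseteq> {1..n}"
  shows "inf (eval v (a_trm n T)) b = bot \<or> eval v (a_trm n T) \<le> b"
proof -
  have "gen_alg v n \<subseteq> {b. inf (eval v (a_trm n T)) b = bot \<or> eval v (a_trm n T) \<le> b}"
  proof (rule gen_alg_least[OF subalgebra_decided_by])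
    fix i assume "i \<in> {1..n}"
    then show "v i \<in> {b. inf (eval v (a_trm n T)) b = bot \<or> eval v (a_trm n T) \<le> b}"
      using eval_a_trm_cases[OF assms(2), of i v] by (auto simp: le_pcomp_iff split: if_splits)
  qed
  with assms(1) show ?thesis by blast
qed

lemma subalgebra_gen_alg: "subalgebra (gen_alg v n)"
proof -
  have "(top :: 'a) = eval v (p_trm n ({}, Pow {1..n}))"
  proof (rule eq_if_same_lower_bounds)
    fix u :: 'a
    show "u \<le> top \<longleftrightarrow> u \<le> eval v (p_trm n ({}, Pow {1..n}))"
      by (subst le_eval_p_trm) (auto simp: shapes_def)
  qed
  then have top: "top \<in> gen_alg v n"
    using eval_p_trm_in_gen_alg[of "({}, Pow {1..n})" n v] by (simp add: shapes_def)
  have pcomp: "pcomp b \<in> gen_alg v n" if b: "b \<in> gen_alg v n" for b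
  proof -
    \<comment> \<open>Every element being decided by the \<open>a\<^sub>T\<close>, its pseudocomplement is the regular element
      spanned by the \<open>a\<^sub>T\<close> disjoint from it.\<close>
    define c where "c = ({} :: nat set, {T. T \<subseteq> {1..n} \<and> inf (eval v (a_trm n T)) b = bot})"
    have c: "c \<in> shapes n" by (auto simp: c_def shapes_def)
    have "pcomp b = eval v (p_trm n c)"
    proof (rule eq_if_same_lower_bounds)
      fix u
      have "u \<le> eval v (p_trm n c) \<longleftrightarrow>
          (\<forall>T. T \<subseteq> {1..n} \<and> inf (eval v (a_trm n T)) b \<noteq> bot \<longrightarrow> inf u (eval v (a_trm n T)) = bot)"
        unfolding le_eval_p_trm[OF c] by (auto simp: c_def)
      also have "\<dots> \<longleftrightarrow> inf u b = bot"
      proof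
        assume *: "\<forall>T. T \<subseteq> {1..n} \<and> inf (eval v (a_trm n T)) b \<noteq> bot \<longrightarrow>
          inf u (eval v (a_trm n T)) = bot"
        show "inf u b = bot"
        proof (rule eq_bot_if_disjoint_a_trm[of n _ v])
          fix T :: "nat set" assume T: "T \<subseteq> {1..n}"
          show "inf (inf u b) (eval v (a_trm n T)) = bot"
            using * T inf_eq_bot_mono[of u "eval v (a_trm n T)" "inf u b" "eval v (a_trm n T)"]
              inf_eq_bot_mono[of b "eval v (a_trm n T)" "inf u b" "eval v (a_trm n T)"]
            by (metis inf_commute inf_le1 inf_le2 order_refl)
        qed
      next
        assume "inf u b = bot"
        then show "\<forall>T. T \<subseteq> {1..n} \<and> inf (eval v (a_trm n T)) b \<noteq> bot \<longrightarrow>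
          inf u (eval v (a_trm n T)) = bot"
          using gen_alg_decided[OF b] inf_eq_bot_mono[of u b u] by blast
      qed
      finally show "u \<le> pcomp b \<longleftrightarrow> u \<le> eval v (p_trm n c)" by (simp add: le_pcomp_iff)
    qed
    then show ?thesis using eval_p_trm_in_gen_alg[OF c, of v] by simp
  qed
  have "inf (eval v (p_trm n c)) (eval v (p_trm n d)) \<in> (\<lambda>c. eval v (p_trm n c)) ` shapes n"
    if "c \<in> shapes n" "d \<in> shapes n" for c d
    using eval_p_trm_meet_shape[OF that, of v] meet_shape_in_shapes[OF that]
    by (intro image_eqI[of _ _ "meet_shape c d"]) simp_all
  then have inf: "inf a b \<in> gen_alg v n" if "a \<in> gen_alg v n" "b \<in> gen_alg v n" for a b
    unfolding gen_alg_def
    by (intro join_closure_inf that[unfolded gen_alg_def]) blast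
  show ?thesis
    unfolding subalgebra_def
    using top inf pcomp join_closure_bot
    unfolding gen_alg_def by (intro conjI ballI) (simp_all add: join_closure_sup)
qed


section \<open>What the formulas say in the generated subalgebra\<close>

lemma sat_At_fm:
  assumes "eval v t \<in> gen_alg v n"
  shows "sat_fm v (At_fm t n) \<longleftrightarrow> atom_in (gen_alg v n) (eval v t)"
proof -
  let ?B = "gen_alg v n" and ?t = "eval v t"
  have "(\<exists>T\<subseteq>{1..n}. ?t = eval v (a_trm n T)) \<longleftrightarrow> (\<forall>b\<in>?B. inf ?t b = bot \<or> ?t \<le> b)" if "?t \<noteq> bot"
  proof
    assume "\<exists>T\<subseteq>{1..n}. ?t = eval v (a_trm n T)"
    then show "\<forall>b\<in>?B. inf ?t b = bot \<or> ?t \<le> b" using gen_alg_decided by metis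
  next
    assume *: "\<forall>b\<in>?B. inf ?t b = bot \<or> ?t \<le> b"
    define T where "T = {i \<in> {1..n}. ?t \<le> v i}"
    have T: "T \<subseteq> {1..n}" by (auto simp: T_def)
    have "?t \<le> eval v (a_trm n T)"
      unfolding le_eval_a_trm[OF T] using * var_in_gen_alg[of _ n v] by (auto simp: T_def le_pcomp_iff)
    then have "\<not> inf (eval v (a_trm n T)) ?t = bot" using that by (simp add: inf.absorb2)
    with \<open>?t \<le> eval v (a_trm n T)\<close> have "?t = eval v (a_trm n T)"
      using gen_alg_decided[OF assms T] by (simp add: order.antisym)
    with T show "\<exists>T\<subseteq>{1..n}. ?t = eval v (a_trm n T)" by blast
  qed
  then show ?thesis using assms by (auto simp: At_fm_def sat_BigOr atom_in_def)
qed

text \<open>Meeting \<open>p\<^sub>c\<close> with any \<open>p\<^sub>d\<close> gives \<open>p\<close> at the meet of the two indices, which is either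
  \<open>c\<close> itself or smaller. So an element \<open>p\<^sub>c\<close> that is not the join of the \<open>p\<^sub>d\<close> with smaller index
  is join-irreducible; conversely, a join-irreducible \<open>p\<^sub>c\<close> is not such a join if \<open>c\<close> is a
  minimal index for it.\<close>

lemma sat_Jirr_fm:
  "sat_fm v (Jirr_fm t n) \<longleftrightarrow>
     jirr_in (gen_alg v n) (eval v t) \<and> (\<exists>c\<in>S_set n. eval v t = eval v (p_trm n c))"
  (is "_ \<longleftrightarrow> jirr_in ?B ?t \<and> _")
proof -
  let ?p = "\<lambda>c. eval v (p_trm n c)" and ?D = "\<lambda>c. {d \<in> S_set n. S_less d c}"
  have sub: "subalgebra ?B" by (rule subalgebra_gen_alg)
  have shape: "c \<in> shapes n" if "c \<in> S_set n" for c using that by (simp add: S_set_eq)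
  have p_in: "?p c \<in> ?B" if "c \<in> S_set n" for c by (rule eval_p_trm_in_gen_alg[OF shape[OF that]])
  have fin: "finite (?D c)" for c by (simp add: finite_S_set)
  have join_le: "eval v (BigJoin (?D c) (p_trm n)) \<le> ?p c" if "c \<in> S_set n" for c
    unfolding eval_BigJoin_le[OF fin]
    using eval_p_trm_mono[OF shape shape[OF that]] by (auto simp: S_less_def)
  show ?thesis
  proof
    assume "sat_fm v (Jirr_fm t n)"
    then obtain c where c: "c \<in> S_set n" "?t = ?p c" "?t \<noteq> eval v (BigJoin (?D c) (p_trm n))"
      by (auto simp: Jirr_fm_def sat_BigOr finite_S_set)
    let ?J = "eval v (BigJoin (?D c) (p_trm n))"
    have J_lt: "\<not> ?t \<le> ?J" using join_le[OF c(1)] c(2,3) by (metis order.antisym)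
    \<comment> \<open>Joins preserve this alternative, and for \<open>b = p\<^sub>d\<close> it records whether the meet of the
      indices \<open>c\<close> and \<open>d\<close> is \<open>c\<close> or smaller.\<close>
    have alt: "inf ?t b \<le> ?J \<or> ?t \<le> b" if "b \<in> ?B" for b
      using that unfolding gen_alg_def
    proof (induction rule: join_closure.induct)
      case join_closure_bot
      then show ?case by simp
    next
      case (join_closure_step g b)
      then obtain d where d: "d \<in> shapes n" "g = ?p d" by blast
      have m: "inf ?t g = ?p (meet_shape c d)"
        unfolding c(2) d(2) by (rule eval_p_trm_meet_shape[OF shape[OF c(1)] d(1), symmetric])
      have "inf ?t g \<le> ?J \<or> ?t \<le> g"
      proof (cases "meet_shape c d = c")
        case True
        then show ?thesis using m c(2) by (simp add: inf.absorb_iff1)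
      next
        case False
        then have "meet_shape c d \<in> ?D c"
          using c(1) meet_shape_in_shapes[OF shape[OF c(1)] d(1)]
          by (auto simp: S_set_eq S_less_def S_le_def meet_shape_def)
        moreover have "\<forall>d\<in>?D c. ?p d \<le> ?J"
          using eval_BigJoin_le[OF fin[of c], of v "p_trm n" ?J] by blast
        ultimately show ?thesis unfolding m by blast
      qed
      with join_closure_step.IH show ?case
        by (auto simp: inf_sup_distrib1 intro: le_supI1 le_supI2)
    qed
    have "?t \<le> a \<or> ?t \<le> b" if "a \<in> ?B" "b \<in> ?B" "?t \<le> sup a b" for a b
    proof (rule ccontr)
      assume "\<not> (?t \<le> a \<or> ?t \<le> b)"
      then have "sup (inf ?t a) (inf ?t b) \<le> ?J"
        using alt[OF that(1)] alt[OF that(2)] by simp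
      then have "inf ?t (sup a b) \<le> ?J" by (simp add: inf_sup_distrib1)
      with that(3) J_lt show False by (simp add: inf.absorb1)
    qed
    moreover have "?t \<noteq> bot" using J_lt by auto
    ultimately have "jirr_in ?B ?t" using p_in[OF c(1)] c(2) by (simp add: jirr_in_def)
    with c show "jirr_in ?B ?t \<and> (\<exists>c\<in>S_set n. ?t = ?p c)" by blast
  next
    assume "jirr_in ?B ?t \<and> (\<exists>c\<in>S_set n. ?t = ?p c)"
    then have jirr: "jirr_in ?B ?t" and "\<exists>c. c \<in> S_set n \<and> ?t = ?p c" by blast+
    \<comment> \<open>An index of the given element that is minimal, as witnessed by a rank strictly
      increasing in the order of indices.\<close>
    define rank where "rank c = card (snd c) + card ({1..n} - fst c)" for c :: "nat set \<times> nat set set"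
    obtain c where c: "c \<in> S_set n" "?t = ?p c"
      and min: "\<And>d. d \<in> S_set n \<and> ?t = ?p d \<Longrightarrow> rank c \<le> rank d"
      using ex_has_least_nat[of "\<lambda>c. c \<in> S_set n \<and> ?t = ?p c" _ rank]
        \<open>\<exists>c. c \<in> S_set n \<and> ?t = ?p c\<close> by (elim exE) blast
    have rank: "rank d < rank c" if "d \<in> ?D c" for d
    proof -
      have c': "snd c \<subseteq> Pow {1..n}" and d: "fst d \<subseteq> {1..n}" "S_le d c" "d \<noteq> c"
        using that c(1) by (auto simp: S_set_def S_less_def)
      have fin: "finite (snd c)" using c' by (simp add: finite_subset)
      have "snd d \<subset> snd c \<or> {1..n} - fst d \<subset> {1..n} - fst c"
        using d by (auto simp: S_le_def prod_eq_iff)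
      moreover have "snd d \<subseteq> snd c" "{1..n} - fst d \<subseteq> {1..n} - fst c"
        using d by (auto simp: S_le_def)
      moreover have "card (snd d) \<le> card (snd c)"
        "card ({1..n} - fst d) \<le> card ({1..n} - fst c)"
        using card_mono[OF fin] card_mono[of "{1..n} - fst c"] calculation(2,3) by simp_all
      ultimately show ?thesis
        unfolding rank_def
        using psubset_card_mono[OF fin] psubset_card_mono[of "{1..n} - fst c" "{1..n} - fst d"]
        by (metis add_le_less_mono add_less_le_mono finite_Diff finite_atLeastAtMost)
    qed
    have "?t \<noteq> eval v (BigJoin (?D c) (p_trm n))"
    proof
      assume "?t = eval v (BigJoin (?D c) (p_trm n))"
      then obtain d where d: "d \<in> ?D c" "?t \<le> ?p d"
        using jirr_in_le_BigJoin[OF fin[of c] sub _ jirr, of v "p_trm n"] p_in by auto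
      have "?p d \<le> ?t"
        using eval_p_trm_mono[of d n c v] d(1) shape c by (auto simp: S_less_def)
      with d(2) have "?t = ?p d" by (rule order.antisym)
      with min[of d] rank[OF d(1)] d(1) show False by simp
    qed
    with c show "sat_fm v (Jirr_fm t n)"
      by (auto simp: Jirr_fm_def sat_BigOr finite_S_set)
  qed
qed

text \<open>Below a generator \<open>x\<^sub>i\<close> the indices with empty \<open>L\<close> can be avoided, because meeting with
  \<open>x\<^sub>i\<close> puts \<open>i\<close> into \<open>L\<close>.\<close>

lemma jirr_in_gen_alg_below_var:
  assumes "jirr_in (gen_alg v n) j" "i \<in> {1..n}" "j \<le> v i"
  shows "\<exists>c\<in>S_set n. j = eval v (p_trm n c)"
proof -
  let ?G = "(\<lambda>c. eval v (p_trm n c)) ` shapes n"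
  have "\<exists>g\<in>?G. j \<le> g \<and> g \<le> b" if "b \<in> join_closure ?G" "j \<le> b" for b
    using that
  proof (induction rule: join_closure.induct)
    case join_closure_bot
    then show ?case using assms(1) by (simp add: jirr_in_def bot.extremum_unique)
  next
    case (join_closure_step g b)
    then have "g \<in> gen_alg v n" "b \<in> gen_alg v n" by (auto simp: gen_alg_def intro: join_closure_base)
    then have "j \<le> g \<or> j \<le> b" using assms(1) join_closure_step.prems by (simp add: jirr_in_def)
    then show ?case
      using join_closure_step.hyps(1) join_closure_step.IH by (meson le_supI2 sup_ge1)
  qed
  then have "\<exists>g\<in>?G. j \<le> g \<and> g \<le> j"
    using jirr_in_mem[OF assms(1)] by (simp add: gen_alg_def)
  then obtain d where d: "d \<in> shapes n" "j = eval v (p_trm n d)" by (auto intro: order.antisym)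
  have "j = eval v (p_trm n (meet_shape d (var_shape n i)))"
    unfolding eval_p_trm_meet_shape[OF d(1) var_shape_in_shapes[OF assms(2)]]
      eval_p_trm_var_shape[OF assms(2)] using d(2) assms(3) by (simp add: inf.absorb1)
  moreover have "meet_shape d (var_shape n i) \<in> S_set n"
    using meet_shape_in_shapes[OF d(1) var_shape_in_shapes[OF assms(2)]]
    by (auto simp: S_set_eq meet_shape_def var_shape_def)
  ultimately show ?thesis by blast
qed

lemma sat_distinct_fm: "sat_fm v (distinct_fm n h) \<longleftrightarrow> inj_on (\<lambda>i. v (n + i)) {1..h}"
proof -
  have "finite {(i, j). 1 \<le> i \<and> i < j \<and> j \<le> h}"
    by (rule finite_subset[of _ "{1..h} \<times> {1..h}"]) auto
  then have "sat_fm v (distinct_fm n h) \<longleftrightarrow>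
      (\<forall>i j. 1 \<le> i \<and> i < j \<and> j \<le> h \<longrightarrow> v (n + i) \<noteq> v (n + j))"
    by (auto simp: distinct_fm_def sat_BigAnd)
  also have "\<dots> \<longleftrightarrow> inj_on (\<lambda>i. v (n + i)) {1..h}"
    by (auto intro!: linorder_inj_onI' dest!: inj_onD)
  finally show ?thesis .
qed

lemma sat_P_fm:
  "sat_fm v (P_fm n m h) \<longleftrightarrow>
    (\<forall>i\<in>{1..h}. v (n + i) \<le> v 1) \<and> (\<forall>j\<in>{h+1..m}. \<not> v (n + j) \<le> v 1)"
  by (simp add: P_fm_def sat_BigAnd inf.absorb_iff1)

lemma sat_Q_fm:
  "sat_fm v (Q_fm n m h f) \<longleftrightarrow>
    (\<forall>i\<in>{1..2 ^ h - 1}. v (n + m + i) \<le> v 1 \<and>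
       (\<forall>j\<in>{1..2 ^ h - 1}. f i \<subseteq> f j \<longrightarrow> v (n + m + i) \<le> v (n + m + j)) \<and>
       (\<forall>j\<in>{1..m}. v (n + j) \<le> v (n + m + i) \<longleftrightarrow> j \<in> f i))"
proof -
  have fin: "finite {(i, j). i \<in> {1..k} \<and> j \<in> {1..l} \<and> R i j}" for k l :: nat and R
    by (rule finite_subset[of _ "{1..k} \<times> {1..l}"]) auto
  show ?thesis
    unfolding Q_fm_def Let_def sat_fm.simps sat_BigAnd[OF fin] sat_BigAnd[OF finite_atLeastAtMost]
    by (simp add: inf.absorb_iff1[symmetric] Ball_def) blast
qed

text \<open>The disjunction over lists of index pairs is a bounded existential quantifier over elements,
  because every join-irreducible element below \<open>x\<^sub>1\<close> is a value \<open>p\<^sub>c\<close>.\<close>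

lemma sat_FS_fm:
  assumes "1 \<le> n"
  shows "sat_fm v (FS_fm n m h f) \<longleftrightarrow>
    (jirr_in (gen_alg v (n + m)) (v 1) \<and> (\<forall>i\<in>{1..m}. atom_in (gen_alg v (n + m)) (v (n + i))) \<and>
     (\<forall>i\<in>{1..h}. v (n + i) \<le> v 1) \<and> (\<forall>j\<in>{h+1..m}. \<not> v (n + j) \<le> v 1) \<and>
     inj_on (\<lambda>i. v (n + i)) {1..h} \<longrightarrow>
     (\<exists>z. \<forall>i\<in>{1..2 ^ h - 1}. jirr_in (gen_alg v (n + m)) (z i) \<and> z i \<le> v 1 \<and>
       (\<forall>j\<in>{1..2 ^ h - 1}. f i \<subseteq> f j \<longrightarrow> z i \<le> z j) \<and>
       (\<forall>j\<in>{1..m}. v (n + j) \<le> z i \<longleftrightarrow> j \<in> f i)))"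
    (is "_ \<longleftrightarrow> (?prem \<longrightarrow> (\<exists>z. ?concl z))")
proof -
  let ?N = "n + m" and ?k = "2 ^ h - 1 :: nat"
  let ?p = "\<lambda>c. eval v (p_trm ?N c)"
  let ?\<sigma> = "\<lambda>w i. if i \<le> ?N then Var i else p_trm ?N (w (i - ?N))"
  have one: "1 \<in> {1..?N}" using assms by simp
  have jirr_x: "sat_fm v (Jirr_fm (Var 1) ?N) \<longleftrightarrow> jirr_in (gen_alg v ?N) (v 1)"
    using jirr_in_gen_alg_below_var[OF _ one order_refl] by (auto simp: sat_Jirr_fm)
  have jirr_p: "sat_fm v (Jirr_fm (p_trm ?N c) ?N) \<longleftrightarrow> jirr_in (gen_alg v ?N) (?p c)"
    if "c \<in> S_set ?N" for c
    using that by (auto simp: sat_Jirr_fm)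
  have at: "sat_fm v (At_fm (Var (n + i)) ?N) \<longleftrightarrow> atom_in (gen_alg v ?N) (v (n + i))"
    if "i \<in> {1..m}" for i
    using that var_in_gen_alg[of "n + i" ?N v] by (subst sat_At_fm) simp_all
  have Q: "sat_fm v (subst_fm (?\<sigma> w) (Q_fm n m h f)) \<longleftrightarrow>
      (\<forall>i\<in>{1..?k}. ?p (w i) \<le> v 1 \<and> (\<forall>j\<in>{1..?k}. f i \<subseteq> f j \<longrightarrow> ?p (w i) \<le> ?p (w j)) \<and>
        (\<forall>j\<in>{1..m}. v (n + j) \<le> ?p (w i) \<longleftrightarrow> j \<in> f i))" for w
    unfolding sat_subst_fm sat_Q_fm using assms by simp
  have fin: "finite ({1..?k} \<rightarrow>\<^sub>E S_set ?N)" by (simp add: finite_PiE finite_S_set)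
  have "sat_fm v (FS_fm n m h f) \<longleftrightarrow> (?prem \<longrightarrow>
      (\<exists>w\<in>{1..?k} \<rightarrow>\<^sub>E S_set ?N. sat_fm v (subst_fm (?\<sigma> w) (Q_fm n m h f)) \<and>
        (\<forall>j\<in>{1..?k}. sat_fm v (Jirr_fm (p_trm ?N (w j)) ?N))))"
    unfolding FS_fm_def F_fm_def sat_fm.simps sat_BigOr[OF fin] sat_BigAnd[OF finite_atLeastAtMost]
      jirr_x sat_P_fm sat_distinct_fm using at by auto
  also have "(\<exists>w\<in>{1..?k} \<rightarrow>\<^sub>E S_set ?N. sat_fm v (subst_fm (?\<sigma> w) (Q_fm n m h f)) \<and>
        (\<forall>j\<in>{1..?k}. sat_fm v (Jirr_fm (p_trm ?N (w j)) ?N))) \<longleftrightarrow> (\<exists>z. ?concl z)"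
  proof
    assume "\<exists>w\<in>{1..?k} \<rightarrow>\<^sub>E S_set ?N. sat_fm v (subst_fm (?\<sigma> w) (Q_fm n m h f)) \<and>
        (\<forall>j\<in>{1..?k}. sat_fm v (Jirr_fm (p_trm ?N (w j)) ?N))"
    then obtain w where w: "w \<in> {1..?k} \<rightarrow>\<^sub>E S_set ?N" "sat_fm v (subst_fm (?\<sigma> w) (Q_fm n m h f))"
      "\<forall>j\<in>{1..?k}. sat_fm v (Jirr_fm (p_trm ?N (w j)) ?N)" by blast
    have "jirr_in (gen_alg v ?N) (?p (w i))" if "i \<in> {1..?k}" for i
      using w(3) that jirr_p[OF PiE_mem[OF w(1) that]] by blast
    then have "?concl (\<lambda>i. ?p (w i))" using w(2) unfolding Q by blast
    then show "\<exists>z. ?concl z" by (rule exI[of ?concl "\<lambda>i. ?p (w i)"])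
  next
    assume "\<exists>z. ?concl z"
    then obtain z where z: "?concl z" by (elim exE)
    then have "\<forall>i\<in>{1..?k}. \<exists>c\<in>S_set ?N. z i = ?p c"
      by (intro ballI jirr_in_gen_alg_below_var[OF _ one]) blast+
    then obtain w where w: "\<forall>i\<in>{1..?k}. w i \<in> S_set ?N \<and> z i = ?p (w i)" by metis
    let ?w = "restrict w {1..?k}"
    have "?w \<in> {1..?k} \<rightarrow>\<^sub>E S_set ?N" using w by auto
    moreover have "sat_fm v (subst_fm (?\<sigma> ?w) (Q_fm n m h f))"
      unfolding Q using z w by simp
    moreover have "sat_fm v (Jirr_fm (p_trm ?N (?w j)) ?N)" if "j \<in> {1..?k}" for j
      using z w that jirr_p[of "w j"] by simp
    ultimately show "\<exists>w\<in>{1..?k} \<rightarrow>\<^sub>E S_set ?N. sat_fm v (subst_fm (?\<sigma> w) (Q_fm n m h f)) \<and>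
        (\<forall>j\<in>{1..?k}. sat_fm v (Jirr_fm (p_trm ?N (w j)) ?N))"
      by blast
  qed
  finally show ?thesis .
qed

lemma sat_DN_fm:
  "(\<forall>v :: nat \<Rightarrow> 'a::pseudocomp_distrib_lattice. sat_fm v DN_fm) \<longleftrightarrow>
   (\<forall>x y z :: 'a. pcomp (pcomp x) = sup y z \<longrightarrow> y = pcomp (pcomp x) \<or> z = pcomp (pcomp x))"
  (is "?L \<longleftrightarrow> ?R")
proof
  assume ?L
  show ?R
  proof (intro allI)
    fix x y z :: 'a
    show "pcomp (pcomp x) = sup y z \<longrightarrow> y = pcomp (pcomp x) \<or> z = pcomp (pcomp x)"
      using \<open>?L\<close>[THEN spec, of "(\<lambda>_. x)(2 := y, 3 := z)"] by (simp add: DN_fm_def Let_def)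
  qed
qed (simp add: DN_fm_def Let_def)

lemma models_Sigma_ax_iff:
  "models TYPE('a::pseudocomp_distrib_lattice) (Sigma_ax f) \<longleftrightarrow>
    (bot :: 'a) \<noteq> top \<and>
    (\<forall>x y z :: 'a. pcomp (pcomp x) = sup y z \<longrightarrow> y = pcomp (pcomp x) \<or> z = pcomp (pcomp x)) \<and>
    (\<forall>n m h. 1 \<le> n \<and> 1 \<le> m \<and> 1 \<le> h \<and> h \<le> m \<longrightarrow> (\<forall>v :: nat \<Rightarrow> 'a. sat_fm v (FS_fm n m h (f h))))"
proof -
  have "models TYPE('a) (Sigma_ax f) \<longleftrightarrow>
    (\<forall>v :: nat \<Rightarrow> 'a. sat_ufm v (univ_closure (Neq ZeroT OneT))) \<and>
    (\<forall>v :: nat \<Rightarrow> 'a. sat_ufm v (univ_closure DN_fm)) \<and>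
    (\<forall>n m h. 1 \<le> n \<and> 1 \<le> m \<and> 1 \<le> h \<and> h \<le> m \<longrightarrow>
      (\<forall>v :: nat \<Rightarrow> 'a. sat_ufm v (univ_closure (FS_fm n m h (f h)))))"
    unfolding models_def Sigma_ax_def by blast
  then show ?thesis unfolding sat_univ_closure sat_DN_fm by simp
qed


section \<open>Regular elements and atoms\<close>

lemma atoms_below_pcomp_pcomp:
  assumes "b \<in> B"
  shows "atoms_below B (pcomp (pcomp b)) = atoms_below B b"
proof -
  have "a \<le> b" if "atom_in B a" "a \<le> pcomp (pcomp b)" for a
  proof (rule ccontr)
    assume "\<not> a \<le> b"
    then have "a \<le> pcomp b" using that(1) assms unfolding atom_in_def le_pcomp_iff by blast
    then have "inf a a = bot" using that(2) by (rule inf_eq_bot_mono[OF inf_pcomp])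
    then show False using that(1) by (simp add: atom_in_def)
  qed
  then show ?thesis using le_pcomp_pcomp[of b] by (auto simp: atoms_below_def intro: order_trans)
qed

text \<open>A regular element of a finite algebra is determined by the atoms below it, and it is the
  largest element with these atoms: what is disjoint from all of them is zero.\<close>

lemma le_pcomp_pcomp_if_atoms_below_subset:
  assumes "finite B" "subalgebra B" "x \<in> B" "b \<in> B" "atoms_below B x \<subseteq> atoms_below B b"
  shows "x \<le> pcomp (pcomp b)"
proof (rule ccontr)
  assume "\<not> x \<le> pcomp (pcomp b)"
  then have "inf x (pcomp b) \<noteq> bot" by (simp add: le_pcomp_iff)
  moreover have "inf x (pcomp b) \<in> B" using assms by (intro subalgebra_inf subalgebra_pcomp)
  ultimately obtain a where a: "a \<in> atoms_below B (inf x (pcomp b))"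
    using ex_atom_below[OF assms(1,2)] by metis
  then have "atom_in B a" "a \<le> x" "a \<le> pcomp b" by (simp_all add: atoms_below_def)
  moreover from this have "a \<le> b" using assms(5) by (auto simp: atoms_below_def)
  ultimately have "inf a a = bot" using inf_eq_bot_mono[OF inf_pcomp[of b]] by blast
  with \<open>atom_in B a\<close> show False by (simp add: atom_in_def)
qed

lemma ex_with_atoms_below:
  assumes "subalgebra B" "finite Y" "Y \<subseteq> atoms_below B top"
  shows "\<exists>b\<in>B. atoms_below B b = Y"
  using assms(2,3)
proof (induction rule: finite_induct)
  case empty
  have "atoms_below B bot = {}" by (auto simp: atoms_below_def atom_in_def bot.extremum_unique)
  with subalgebra_bot[OF assms(1)] show ?case by blast
next
  case (insert y Y)
  then obtain b where b: "b \<in> B" "atoms_below B b = Y" by auto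
  have y: "atom_in B y" using insert.prems by (simp add: atoms_below_def)
  then have yB: "y \<in> B" by (simp add: atom_in_def)
  have "a \<le> sup y b \<longleftrightarrow> a = y \<or> a \<le> b" if "atom_in B a" for a
  proof -
    have "a \<le> sup y b \<longleftrightarrow> a \<le> y \<or> a \<le> b"
      using atom_in_imp_jirr_in[OF that] yB b(1) by (auto simp: jirr_in_def intro: le_supI1 le_supI2)
    then show ?thesis using atom_in_eq[OF that y] by blast
  qed
  then have "atoms_below B (sup y b) = insert y Y"
    using b(2) y by (auto simp: atoms_below_def)
  then show ?case using subalgebra_sup[OF assms(1) yB b(1)] by blast
qed


section \<open>From free skeletons to the sentences\<close>

text \<open>A nonzero regular element coincides with the skeleton element that belongs to the top and
  to the set of its atoms: condition (iii) puts every join-irreducible element below the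
  regular one under the skeleton element.\<close>

lemma lattice_skeleton_jirr_in_regular:
  assumes "finite B" "subalgebra B" "lattice_skeleton B s" "x \<in> B" "pcomp (pcomp x) \<noteq> bot"
  shows "jirr_in B (pcomp (pcomp x))"
proof -
  let ?u = "pcomp (pcomp x)"
  let ?Y = "atoms_below B ?u"
  have u: "?u \<in> B" using assms(2,4) by (intro subalgebra_pcomp)
  have Y: "?Y \<noteq> {}" "?Y \<subseteq> atoms_below B top"
    using ex_atom_below[OF assms(1,2) u assms(5)] by (auto simp: atoms_below_def)
  have j: "jirr_in B (s top ?Y)" "atoms_below B (s top ?Y) = ?Y"
    and max: "\<And>k. jirr_in B k \<Longrightarrow> atoms_below B k \<subseteq> ?Y \<Longrightarrow> k \<le> s top ?Y"
    using assms(3) Y unfolding lattice_skeleton_def by simp_all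
  have "s top ?Y \<le> ?u"
    using le_pcomp_pcomp_if_atoms_below_subset[OF assms(1,2) jirr_in_mem[OF j(1)] assms(4)] j(2)
      atoms_below_pcomp_pcomp[OF assms(4)] by simp
  moreover have "?u \<le> s top ?Y"
  proof (rule ccontr)
    assume "\<not> ?u \<le> s top ?Y"
    then obtain k where k: "jirr_in B k" "k \<le> ?u" "\<not> k \<le> s top ?Y"
      using ex_jirr_in_separating[OF assms(1,2) u] by blast
    then have "atoms_below B k \<subseteq> ?Y" by (auto simp: atoms_below_def)
    with max k show False by blast
  qed
  ultimately have "s top ?Y = ?u" by (rule order.antisym)
  with j(1) show ?thesis by simp
qed

text \<open>The witness \<open>z\<^sub>i\<close> is the skeleton element for the atoms \<open>y\<^sub>j\<close> with \<open>j \<in> f i\<close>. It is not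
  above any other \<open>y\<^sub>j\<close> with \<open>j \<le> h\<close> because these atoms are distinct, nor above \<open>y\<^sub>j\<close> with
  \<open>j > h\<close> because such a \<open>y\<^sub>j\<close> is not even below \<open>x\<^sub>1\<close>.\<close>

lemma sat_FS_fm_if_lattice_skeleton:
  assumes "lattice_skeleton (gen_alg v (n + m)) s" "1 \<le> n" "h \<le> m"
    and f: "bij_betw f {1..2 ^ h - 1} (Pow {1..h} - {{}})"
  shows "sat_fm v (FS_fm n m h f)"
  unfolding sat_FS_fm[OF assms(2)]
proof (intro impI, elim conjE)
  let ?B = "gen_alg v (n + m)" and ?k = "2 ^ h - 1 :: nat"
  let ?y = "\<lambda>j. v (n + j)"
  assume x: "jirr_in ?B (v 1)" and y: "\<forall>i\<in>{1..m}. atom_in ?B (?y i)"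
    and below: "\<forall>i\<in>{1..h}. ?y i \<le> v 1" and not_below: "\<forall>j\<in>{h+1..m}. \<not> ?y j \<le> v 1"
    and inj: "inj_on ?y {1..h}"
  have f_i: "f i \<noteq> {}" "f i \<subseteq> {1..h}" if "i \<in> {1..?k}" for i
    using bij_betwE[OF f] that by blast+
  have Y: "?y ` f i \<noteq> {}" "?y ` f i \<subseteq> atoms_below ?B (v 1)" if "i \<in> {1..?k}" for i
  proof -
    have "?y j \<in> atoms_below ?B (v 1)" if "j \<in> {1..h}" for j
      using y below that assms(3) by (simp add: atoms_below_def)
    then show "?y ` f i \<noteq> {}" "?y ` f i \<subseteq> atoms_below ?B (v 1)" using f_i[OF that] by blast+
  qed
  define z where "z i = s (v 1) (?y ` f i)" for i
  have z: "jirr_in ?B (z i)" "z i \<le> v 1" "atoms_below ?B (z i) = ?y ` f i" if "i \<in> {1..?k}" for i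
    using assms(1) x Y[OF that] unfolding lattice_skeleton_def z_def by simp_all
  have mono: "z i \<le> z j" if "i \<in> {1..?k}" "j \<in> {1..?k}" "f i \<subseteq> f j" for i j
    using assms(1) x Y(1)[OF that(1)] Y(2)[OF that(2)] image_mono[OF that(3), of ?y]
    unfolding lattice_skeleton_def z_def by simp
  have iff: "?y j \<le> z i \<longleftrightarrow> j \<in> f i" if "i \<in> {1..?k}" "j \<in> {1..m}" for i j
  proof -
    have "?y j \<le> z i \<longleftrightarrow> ?y j \<in> ?y ` f i"
      using y that(2) unfolding z(3)[OF that(1), symmetric] by (simp add: atoms_below_def)
    also have "\<dots> \<longleftrightarrow> j \<in> f i"
    proof (cases "j \<le> h")
      case True
      then show ?thesis using inj_on_image_mem_iff[OF inj _ f_i(2)[OF that(1)], of j] that(2) by simp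
    next
      case False
      then have "\<not> ?y j \<le> v 1" using not_below that(2) by simp
      then show ?thesis using False f_i(2)[OF that(1)] below by auto
    qed
    finally show ?thesis .
  qed
  show "\<exists>z. \<forall>i\<in>{1..?k}. jirr_in ?B (z i) \<and> z i \<le> v 1 \<and>
       (\<forall>j\<in>{1..?k}. f i \<subseteq> f j \<longrightarrow> z i \<le> z j) \<and> (\<forall>j\<in>{1..m}. ?y j \<le> z i \<longleftrightarrow> j \<in> f i)"
    by (rule exI[of _ z]) (use z mono iff in blast)
qed


section \<open>From the sentences to free skeletons\<close>

text \<open>The sentence used for the skeleton elements below \<open>x\<close>: the tuple \<open>x\<^sub>1, \<dots>, x\<^sub>n\<close> starts with
  \<open>x\<close> and enumerates the whole algebra, so that it is the algebra generated, and the \<open>y\<^sub>j\<close> are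
  exactly the atoms below \<open>x\<close>. The remaining atoms need no name, because the witnesses lie
  below \<open>x\<close>.\<close>

lemma ex_skeleton_below:
  fixes B :: "'a::pseudocomp_distrib_lattice set"
  assumes "finite B" "subalgebra B" "jirr_in B x"
    and f: "\<And>h. 1 \<le> h \<Longrightarrow> bij_betw (f h) {1..2 ^ h - 1} (Pow {1..h} - {{}})"
    and FS: "\<And>n m h (v :: nat \<Rightarrow> 'a). 1 \<le> n \<Longrightarrow> 1 \<le> m \<Longrightarrow> 1 \<le> h \<Longrightarrow> h \<le> m \<Longrightarrow>
      sat_fm v (FS_fm n m h (f h))"
  shows "\<exists>r. (\<forall>Y. Y \<noteq> {} \<and> Y \<subseteq> atoms_below B x \<longrightarrow>
        jirr_in B (r Y) \<and> r Y \<le> x \<and> atoms_below B (r Y) = Y) \<and>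
      (\<forall>Y Z. Y \<noteq> {} \<and> Y \<subseteq> Z \<and> Z \<subseteq> atoms_below B x \<longrightarrow> r Y \<le> r Z)"
proof -
  let ?A = "atoms_below B x"
  define h where "h = card ?A"
  define n where "n = card B + 1"
  let ?k = "2 ^ h - 1 :: nat"
  have A_fin: "finite ?A"
    by (rule finite_subset[OF _ assms(1)]) (auto simp: atoms_below_def atom_in_def)
  have xB: "x \<in> B" "x \<noteq> bot" using assms(3) by (simp_all add: jirr_in_def)
  obtain a where "a \<in> ?A" using ex_atom_below[OF assms(1,2) xB] by blast
  then have h1: "1 \<le> h" using A_fin by (auto simp: h_def Suc_le_eq card_gt_0_iff)
  obtain g where g: "bij_betw g {1..h} ?A"
    using ex_bij_betw_nat_finite_1[OF A_fin] unfolding h_def by blast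
  obtain e where e: "bij_betw e {1..card B} B"
    using ex_bij_betw_nat_finite_1[OF assms(1)] by blast
  \<comment> \<open>The value at \<open>0\<close>, which is the index of no variable of the sentence, is arbitrary.\<close>
  define v where "v i = (if i \<le> 1 then x else if i \<le> n then e (i - 1) else g (i - n))" for i
  have v1: "v 1 = x" by (simp add: v_def)
  have vg: "v (n + j) = g j" if "j \<in> {1..h}" for j using that by (simp add: v_def n_def)
  have v_in: "v i \<in> B" if "i \<in> {1..n + h}" for i
  proof (cases "i \<le> n")
    case True
    moreover have "e (i - 1) \<in> B" if "\<not> i \<le> 1"
      by (rule bspec[OF bij_betwE[OF e]]) (use True that in \<open>auto simp: n_def\<close>)
    ultimately show ?thesis using xB(1) by (simp add: v_def)
  next
    case False
    have "g (i - n) \<in> ?A"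
      by (rule bspec[OF bij_betwE[OF g]]) (use False that in auto)
    then show ?thesis using False by (auto simp: v_def n_def atoms_below_def atom_in_def)
  qed
  have gen: "gen_alg v (n + h) = B"
  proof
    show "gen_alg v (n + h) \<subseteq> B" by (rule gen_alg_least[OF assms(2) v_in])
    show "B \<subseteq> gen_alg v (n + h)"
    proof
      fix b assume "b \<in> B"
      then obtain i where i: "i \<in> {1..card B}" "b = e i" using bij_betw_imp_surj_on[OF e] by blast
      then have "v (i + 1) = b" by (simp add: v_def n_def)
      with i show "b \<in> gen_alg v (n + h)" using var_in_gen_alg[of "i + 1" "n + h" v] by (simp add: n_def)
    qed
  qed
  have A_iff: "\<And>j. j \<in> {1..h} \<Longrightarrow> g j \<in> ?A" using bij_betwE[OF g] by blast
  have inj: "inj_on (\<lambda>j. v (n + j)) {1..h}"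
    using bij_betw_imp_inj_on[OF g] by (subst inj_on_cong[OF vg])
  have prem: "jirr_in (gen_alg v (n + h)) (v 1) \<and>
      (\<forall>i\<in>{1..h}. atom_in (gen_alg v (n + h)) (v (n + i))) \<and> (\<forall>i\<in>{1..h}. v (n + i) \<le> v 1) \<and>
      (\<forall>j\<in>{h+1..h}. \<not> v (n + j) \<le> v 1) \<and> inj_on (\<lambda>i. v (n + i)) {1..h}"
    unfolding gen v1 using assms(3) A_iff inj vg by (simp add: atoms_below_def)
  have "1 \<le> n" by (simp add: n_def)
  have "\<exists>z. \<forall>i\<in>{1..?k}. jirr_in (gen_alg v (n + h)) (z i) \<and> z i \<le> v 1 \<and>
      (\<forall>j\<in>{1..?k}. f h i \<subseteq> f h j \<longrightarrow> z i \<le> z j) \<and>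
      (\<forall>j\<in>{1..h}. v (n + j) \<le> z i \<longleftrightarrow> j \<in> f h i)"
    using FS[OF \<open>1 \<le> n\<close> h1 h1 order_refl, of v] prem unfolding sat_FS_fm[OF \<open>1 \<le> n\<close>] by (rule mp)
  then obtain z where z: "\<forall>i\<in>{1..?k}. jirr_in B (z i) \<and> z i \<le> x \<and>
      (\<forall>j\<in>{1..?k}. f h i \<subseteq> f h j \<longrightarrow> z i \<le> z j) \<and>
      (\<forall>j\<in>{1..h}. v (n + j) \<le> z i \<longleftrightarrow> j \<in> f h i)"
    unfolding gen v1 by (elim exE)
  define names where "names Y = {j \<in> {1..h}. g j \<in> Y}" for Y
  define index where "index Y = inv_into {1..?k} (f h) (names Y)" for Y
  have index: "index Y \<in> {1..?k}" "f h (index Y) = names Y" if "Y \<noteq> {}" "Y \<subseteq> ?A" for Y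
  proof -
    from that(1) obtain a where "a \<in> Y" by blast
    then have "a \<in> g ` {1..h}" unfolding bij_betw_imp_surj_on[OF g] using that(2) by blast
    then obtain j where "j \<in> {1..h}" "g j \<in> Y" using \<open>a \<in> Y\<close> by blast
    then have "j \<in> names Y" by (simp add: names_def)
    then have "names Y \<in> f h ` {1..?k}"
      unfolding bij_betw_imp_surj_on[OF f[OF h1]] by (auto simp: names_def)
    then show "index Y \<in> {1..?k}" "f h (index Y) = names Y"
      unfolding index_def by (rule inv_into_into, rule f_inv_into_f)
  qed
  have r1: "jirr_in B (z (index Y)) \<and> z (index Y) \<le> x \<and> atoms_below B (z (index Y)) = Y"
    if "Y \<noteq> {}" "Y \<subseteq> ?A" for Y
  proof -
    let ?z = "z (index Y)"
    have zi: "jirr_in B ?z" "?z \<le> x" "\<forall>j\<in>{1..h}. v (n + j) \<le> ?z \<longleftrightarrow> j \<in> names Y"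
      using bspec[OF z index(1)[OF that]] index(2)[OF that] by simp_all
    have mem: "a \<le> ?z \<longleftrightarrow> a \<in> Y" if "a \<in> ?A" for a
    proof -
      have "a \<in> g ` {1..h}" unfolding bij_betw_imp_surj_on[OF g] using \<open>a \<in> ?A\<close> .
      then obtain j where "j \<in> {1..h}" "a = g j" by blast
      then show ?thesis using zi(3) vg by (simp add: names_def)
    qed
    have "atoms_below B ?z \<subseteq> ?A" using zi(2) by (auto simp: atoms_below_def)
    then have "a \<in> atoms_below B ?z \<longleftrightarrow> a \<in> Y" for a
      using mem[of a] \<open>Y \<subseteq> ?A\<close> by (auto simp: atoms_below_def)
    then have "atoms_below B ?z = Y" by blast
    with zi show ?thesis by blast
  qed
  have r2: "z (index Y) \<le> z (index Z)" if "Y \<noteq> {}" "Y \<subseteq> Z" "Z \<subseteq> ?A" for Y Z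
  proof -
    have YZ: "Y \<subseteq> ?A" "Z \<noteq> {}" using that by blast+
    have "names Y \<subseteq> names Z" using that(2) by (auto simp: names_def)
    then show ?thesis
      using bspec[OF z index(1)[OF that(1) YZ(1)]] index[OF YZ(2) that(3)] index(2)[OF that(1) YZ(1)]
      by simp
  qed
  show ?thesis
    by (rule exI[of _ "\<lambda>Y. z (index Y)"]) (use r1 r2 in simp)
qed

text \<open>Only the skeleton elements that belong to the top have to satisfy (iii). They are the
  regular elements, which the sentence about double negations makes join-irreducible.\<close>

lemma ex_lattice_skeleton:
  fixes B :: "'a::pseudocomp_distrib_lattice set"
  assumes "finite B" "subalgebra B" "(bot :: 'a) \<noteq> top"
    and DN: "\<And>x y z :: 'a. pcomp (pcomp x) = sup y z \<Longrightarrow> y = pcomp (pcomp x) \<or> z = pcomp (pcomp x)"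
    and f: "\<And>h. 1 \<le> h \<Longrightarrow> bij_betw (f h) {1..2 ^ h - 1} (Pow {1..h} - {{}})"
    and FS: "\<And>n m h (v :: nat \<Rightarrow> 'a). 1 \<le> n \<Longrightarrow> 1 \<le> m \<Longrightarrow> 1 \<le> h \<Longrightarrow> h \<le> m \<Longrightarrow>
      sat_fm v (FS_fm n m h (f h))"
  shows "\<exists>s. lattice_skeleton B s"
proof -
  have regular: "jirr_in B (pcomp (pcomp b))" if "b \<in> B" "pcomp (pcomp b) \<noteq> bot" for b
  proof -
    have "pcomp (pcomp b) \<le> c \<or> pcomp (pcomp b) \<le> d" if "pcomp (pcomp b) \<le> sup c d" for c d
    proof -
      have "pcomp (pcomp b) = sup (inf (pcomp (pcomp b)) c) (inf (pcomp (pcomp b)) d)"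
        using that by (simp add: inf_sup_distrib1[symmetric] inf.absorb1)
      from DN[OF this] show ?thesis by (simp add: inf.absorb_iff1)
    qed
    moreover have "pcomp (pcomp b) \<in> B" using that(1) assms(2) by (intro subalgebra_pcomp)
    ultimately show ?thesis using that(2) by (simp add: jirr_in_def)
  qed
  have top: "jirr_in B top"
    using regular[OF subalgebra_top[OF assms(2)]] assms(3) by (simp add: pcomp_pcomp_top)
  have "\<exists>b\<in>B. atoms_below B b = Y" if "Y \<subseteq> atoms_below B top" for Y
    by (rule ex_with_atoms_below[OF assms(2) finite_subset[OF _ assms(1)] that])
      (use that in \<open>auto simp: atoms_below_def atom_in_def\<close>)
  then obtain b where b: "\<And>Y. Y \<subseteq> atoms_below B top \<Longrightarrow> b Y \<in> B \<and> atoms_below B (b Y) = Y"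
    by metis
  have "\<forall>x\<in>{x. jirr_in B x}. \<exists>r. (\<forall>Y. Y \<noteq> {} \<and> Y \<subseteq> atoms_below B x \<longrightarrow>
        jirr_in B (r Y) \<and> r Y \<le> x \<and> atoms_below B (r Y) = Y) \<and>
      (\<forall>Y Z. Y \<noteq> {} \<and> Y \<subseteq> Z \<and> Z \<subseteq> atoms_below B x \<longrightarrow> r Y \<le> r Z)"
    using ex_skeleton_below[OF assms(1,2) _ f FS] by blast
  from bchoice[OF this] obtain r where r: "\<forall>x\<in>{x. jirr_in B x}. (\<forall>Y. Y \<noteq> {} \<and> Y \<subseteq> atoms_below B x \<longrightarrow>
        jirr_in B (r x Y) \<and> r x Y \<le> x \<and> atoms_below B (r x Y) = Y) \<and>
      (\<forall>Y Z. Y \<noteq> {} \<and> Y \<subseteq> Z \<and> Z \<subseteq> atoms_below B x \<longrightarrow> r x Y \<le> r x Z)"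
    ..
  define s where "s x Y = (if x = top then pcomp (pcomp (b Y)) else r x Y)" for x Y
  have le_s_top: "x \<le> s top Y" if "x \<in> B" "Y \<subseteq> atoms_below B top" "atoms_below B x \<subseteq> Y" for x Y
    using le_pcomp_pcomp_if_atoms_below_subset[OF assms(1,2) that(1), of "b Y"] b[OF that(2)] that(3)
    by (simp add: s_def)
  have s_top: "jirr_in B (s top Y)" "atoms_below B (s top Y) = Y"
    if "Y \<noteq> {}" "Y \<subseteq> atoms_below B top" for Y
  proof -
    have atoms: "atoms_below B (pcomp (pcomp (b Y))) = Y"
      using b[OF that(2)] atoms_below_pcomp_pcomp[of "b Y" B] by simp
    moreover have "atoms_below B bot = {}"
      by (auto simp: atoms_below_def atom_in_def bot.extremum_unique)
    ultimately have "pcomp (pcomp (b Y)) \<noteq> bot" using that(1) by metis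
    then show "jirr_in B (s top Y)" "atoms_below B (s top Y) = Y"
      using regular b[OF that(2)] atoms by (simp_all add: s_def)
  qed
  have s1: "jirr_in B (s x Y) \<and> s x Y \<le> x \<and> atoms_below B (s x Y) = Y"
    if "jirr_in B x" "Y \<noteq> {}" "Y \<subseteq> atoms_below B x" for x Y
  proof (cases "x = top")
    case True
    then show ?thesis using s_top that by simp
  next
    case False
    then show ?thesis using r that by (simp add: s_def)
  qed
  have s2: "s x Y \<le> s x Z"
    if "jirr_in B x" "Y \<noteq> {}" "Y \<subseteq> Z" "Z \<subseteq> atoms_below B x" for x Y Z
  proof (cases "x = top")
    case True
    have Y: "Y \<subseteq> atoms_below B top" using that(3,4) True by blast
    show ?thesis
      using le_s_top[of "s top Y" Z] jirr_in_mem[OF s_top(1)[OF that(2) Y]] s_top(2)[OF that(2) Y]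
        that(3,4) True by simp
  next
    case False
    then show ?thesis using r that by (simp add: s_def)
  qed
  have "lattice_skeleton B s"
    unfolding lattice_skeleton_def
    using top s1 s2 le_s_top[OF jirr_in_mem] by (intro conjI allI impI) simp_all
  then show ?thesis by (rule exI[of _ s])
qed

theorem proposition7p12:
  fixes f :: "nat \<Rightarrow> nat \<Rightarrow> nat set"
  assumes "\<And>h. h \<ge> 1 \<Longrightarrow> bij_betw (f h) {1..2 ^ h - 1} (Pow {1..h} - {{}})"
  shows "models TYPE('a::pseudocomp_distrib_lattice) (Sigma_ax f) \<longleftrightarrow>
    (\<forall>B :: 'a set. subalgebra B \<and> finite B \<longrightarrow> has_free_skeleton (dual_poset B))"
proof
  assume "models TYPE('a) (Sigma_ax f)"
  then have ax: "(bot :: 'a) \<noteq> top"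
    "\<And>x y z :: 'a. pcomp (pcomp x) = sup y z \<Longrightarrow> y = pcomp (pcomp x) \<or> z = pcomp (pcomp x)"
    "\<And>n m h (v :: nat \<Rightarrow> 'a). 1 \<le> n \<Longrightarrow> 1 \<le> m \<Longrightarrow> 1 \<le> h \<Longrightarrow> h \<le> m \<Longrightarrow> sat_fm v (FS_fm n m h (f h))"
    unfolding models_Sigma_ax_iff by blast+
  show "\<forall>B :: 'a set. subalgebra B \<and> finite B \<longrightarrow> has_free_skeleton (dual_poset B)"
  proof (intro allI impI, elim conjE)
    fix B :: "'a set"
    assume B: "subalgebra B" "finite B"
    show "has_free_skeleton (dual_poset B)"
      unfolding has_free_skeleton_iff[OF B(2,1)]
      by (rule ex_lattice_skeleton[OF B(2,1) ax(1,2) assms ax(3)])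
  qed
next
  assume skel: "\<forall>B :: 'a set. subalgebra B \<and> finite B \<longrightarrow> has_free_skeleton (dual_poset B)"
  have gen_skel: "\<exists>s. lattice_skeleton (gen_alg v n) s" for v :: "nat \<Rightarrow> 'a" and n
    using skel[rule_format, OF conjI, OF subalgebra_gen_alg finite_gen_alg]
    unfolding has_free_skeleton_iff[OF finite_gen_alg subalgebra_gen_alg] .
  have "(bot :: 'a) \<noteq> top"
    using gen_skel[of "\<lambda>_. bot" 0] by (auto simp: lattice_skeleton_def jirr_in_def)
  moreover have "y = pcomp (pcomp x) \<or> z = pcomp (pcomp x)" if "pcomp (pcomp x) = sup y z" for x y z :: 'a
  proof (cases "pcomp (pcomp x) = bot")
    case True
    then show ?thesis using that by (simp add: sup_eq_bot_iff)
  next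
    case False
    define v :: "nat \<Rightarrow> 'a" where "v = (\<lambda>_. x)(2 := y, 3 := z)"
    have "v 1 \<in> gen_alg v 3" "v 2 \<in> gen_alg v 3" "v 3 \<in> gen_alg v 3"
      by (rule var_in_gen_alg, simp)+
    then have in_B: "x \<in> gen_alg v 3" "y \<in> gen_alg v 3" "z \<in> gen_alg v 3" by (simp_all add: v_def)
    obtain s where "lattice_skeleton (gen_alg v 3) s" using gen_skel by blast
    then have "jirr_in (gen_alg v 3) (pcomp (pcomp x))"
      by (rule lattice_skeleton_jirr_in_regular[OF finite_gen_alg subalgebra_gen_alg _ in_B(1) False])
    then have "pcomp (pcomp x) \<le> y \<or> pcomp (pcomp x) \<le> z"
      using in_B that unfolding jirr_in_def by (metis order_refl)
    then show ?thesis using that by (auto intro: order.antisym)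
  qed
  moreover have "sat_fm v (FS_fm n m h (f h))" if "1 \<le> n" "1 \<le> h" "h \<le> m" for v :: "nat \<Rightarrow> 'a" and n m h
  proof -
    obtain s where "lattice_skeleton (gen_alg v (n + m)) s" using gen_skel by blast
    then show ?thesis by (rule sat_FS_fm_if_lattice_skeleton[OF _ that(1,3) assms[OF that(2)]])
  qed
  ultimately show "models TYPE('a) (Sigma_ax f)"
    unfolding models_Sigma_ax_iff by blast
qed

end
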